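(* Let $n\ge2$ be an integer and let $\alpha>p-1>0$. Then $-\Delta_p^H u=-u^\alpha$ in $\mathbb{R}^n$ admits no positive subsolution.
   Context: $H\in C^2(\mathbb{R}^n\setminus\{0\})\cap C(\mathbb{R}^n)$ is a fixed positively homogeneous function of degree one ($H(t\xi)=tH(\xi)$ for $t>0$, $H(0)=0$), positive on $\mathbb{S}^{n-1}$ (not assumed even), and uniformly convex, i.e. the unit ball $\{\xi: H(\xi)<1\}$ is uniformly convex (its boundary has principal curvatures bounded below by a positive constant). Set $a(\xi)=\frac1p\nabla_\xi H^p(\xi)$ (with $a(0)=0$) and $\Delta_p^H u=\operatorname{div}(a(\nabla u))$. A positive subsolution of $-\Delta_p^H u=-u^\alpha$ in $\mathbb{R}^n$ is a function $u\in W^{1,p}_{\mathrm{loc}}(\mathbb{R}^n)\cap C(\mathbb{R}^n)$ with $u>0$ in $\mathbb{R}^n$ such that $\int_{\mathbb{R}^n}a(\nabla u)\cdot\nabla\varphi\le-\int_{\mathbb{R}^n}u^\alpha\varphi$ for all $\varphi\in C_c^\infty(\mathbb{R}^n)$ with $\varphi\ge0$. *)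

theory Defs
  imports "HOL-Analysis.Analysis"
begin

section \<open>Classical derivatives and test functions\<close>

definition grad :: "('a::real_inner \<Rightarrow> real) \<Rightarrow> 'a \<Rightarrow> 'a" where
  "grad f x = (THE D. GDERIV f x :> D)"

text \<open>On an open set, \<open>C_diff_on k\<close> says that all partial derivatives up to order \<open>k\<close>
  exist and are continuous.\<close>

primrec C_diff_on :: "nat \<Rightarrow> ('a::real_normed_vector \<Rightarrow> real) \<Rightarrow> 'a set \<Rightarrow> bool" where
  "C_diff_on 0 f S \<longleftrightarrow> continuous_on S f"
| "C_diff_on (Suc k) f S \<longleftrightarrow>
     (\<forall>x\<in>S. f differentiable (at x)) \<and>
     (\<forall>v. C_diff_on k (\<lambda>x. frechet_derivative f (at x) v) S)"

definition test_function :: "('a::real_normed_vector \<Rightarrow> real) \<Rightarrow> bool" where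
  "test_function \<phi> \<longleftrightarrow>
     (\<forall>k. C_diff_on k \<phi> UNIV) \<and> compact (closure {x. \<phi> x \<noteq> 0})"

section \<open>Local Sobolev spaces\<close>

definition Lp_loc :: "real \<Rightarrow> ('a::euclidean_space \<Rightarrow> 'b::euclidean_space) set" where
  "Lp_loc p = {f. f \<in> borel_measurable lebesgue \<and>
     (\<forall>K. compact K \<longrightarrow> set_integrable lebesgue K (\<lambda>x. norm (f x) powr p))}"

definition has_weak_gradient :: "('a::euclidean_space \<Rightarrow> real) \<Rightarrow> ('a \<Rightarrow> 'a) \<Rightarrow> bool" where
  "has_weak_gradient u g \<longleftrightarrow> u \<in> Lp_loc 1 \<and> g \<in> Lp_loc 1 \<and>
     (\<forall>\<phi>. test_function \<phi> \<longrightarrow>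
        (\<integral>x. u x *\<^sub>R grad \<phi> x \<partial>lebesgue) = - (\<integral>x. \<phi> x *\<^sub>R g x \<partial>lebesgue))"

text \<open>The weak gradient is unique only up to null sets; \<open>weak_grad\<close> selects a representative.\<close>

definition weak_grad :: "('a::euclidean_space \<Rightarrow> real) \<Rightarrow> 'a \<Rightarrow> 'a" where
  "weak_grad u = (SOME g. has_weak_gradient u g)"

definition W1p_loc :: "real \<Rightarrow> ('a::euclidean_space \<Rightarrow> real) set" where
  "W1p_loc p = {u. u \<in> Lp_loc p \<and> (\<exists>g. has_weak_gradient u g) \<and> weak_grad u \<in> Lp_loc p}"

section \<open>Uniform convexity\<close>

text \<open>On a regular level set of \<open>H\<close>, the map \<open>gauss_map H\<close> is the unit normal pointing towards
  larger values of \<open>H\<close>, that is, the outer normal of the sublevel set. Principal curvatures are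
  the eigenvalues of its derivative on the tangent space (the Weingarten map); they are
  positive for round spheres, with \<open>H = norm\<close>.\<close>

definition gauss_map :: "('a::real_inner \<Rightarrow> real) \<Rightarrow> 'a \<Rightarrow> 'a" where
  "gauss_map H x = sgn (grad H x)"

definition principal_curvature :: "('a::real_inner \<Rightarrow> real) \<Rightarrow> 'a \<Rightarrow> real \<Rightarrow> bool" where
  "principal_curvature H x \<kappa> \<longleftrightarrow>
     (\<exists>v. v \<noteq> 0 \<and> v \<bullet> grad H x = 0 \<and>
          frechet_derivative (gauss_map H) (at x) v = \<kappa> *\<^sub>R v)"

definition uniformly_convex :: "('a::real_inner \<Rightarrow> real) \<Rightarrow> bool" where
  "uniformly_convex H \<longleftrightarrow>
     (\<exists>c>0. \<forall>x \<in> frontier {\<xi>. H \<xi> < 1}. \<forall>\<kappa>. principal_curvature H x \<kappa> \<longrightarrow> c \<le> \<kappa>)"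

section \<open>The anisotropic p-Laplacian\<close>

definition aniso_flux :: "('a::real_inner \<Rightarrow> real) \<Rightarrow> real \<Rightarrow> 'a \<Rightarrow> 'a" where
  "aniso_flux H p \<xi> = (if \<xi> = 0 then 0 else (1 / p) *\<^sub>R grad (\<lambda>\<eta>. H \<eta> powr p) \<xi>)"

definition positive_subsolution ::
    "('a::euclidean_space \<Rightarrow> real) \<Rightarrow> real \<Rightarrow> real \<Rightarrow> ('a \<Rightarrow> real) \<Rightarrow> bool" where
  "positive_subsolution H p \<alpha> u \<longleftrightarrow>
     u \<in> W1p_loc p \<and> continuous_on UNIV u \<and> (\<forall>x. u x > 0) \<and>
     (\<forall>\<phi>. test_function \<phi> \<and> (\<forall>x. \<phi> x \<ge> 0) \<longrightarrow>
        (\<integral>x. aniso_flux H p (weak_grad u x) \<bullet> grad \<phi> x \<partial>lebesgue)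
          \<le> - (\<integral>x. u x powr \<alpha> * \<phi> x \<partial>lebesgue))"

end

theory Submission
  imports Defs
begin

text \<open>Only the structure of the flux matters: \<open>a\<close> is continuous away from the origin and
  homogeneous of degree \<open>p - 1\<close>, and Euler's identity turns \<open>a \<xi> \<bullet> \<xi>\<close> into \<open>H \<xi> powr p\<close>.
  Testing with \<open>u ^ m * \<theta> ^ k\<close>, where \<open>\<theta>\<close> is a cut-off at scale \<open>R\<close>, and absorbing the term with the
  gradient of \<open>\<theta>\<close> partly into the energy and partly into the absorption term bounds the integral of
  \<open>u powr (\<alpha> + m)\<close> over a ball of radius \<open>R / 2\<close> by a multiple of \<open>R powr (n - q)\<close>, where
  \<open>q = p * (\<alpha> + m) / (\<alpha> - p + 1)\<close>. For large \<open>m\<close> the exponent is negative, and \<open>R \<rightarrow> \<infinity>\<close>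
  contradicts positivity. The test function becomes smooth on replacing \<open>u\<close> by mollifications, whose
  gradients converge in \<open>L\<^sup>p\<close> on balls.\<close>

section \<open>Smooth functions and cut-offs\<close>

text \<open>No growth of \<open>u\<close> at infinity is prescribed, so every estimate has to be
  local with constants independent of \<open>u\<close>. Write s for the norm of the gradient of
  \<open>u\<close> and z for the norm of the gradient of \<theta> divided by \<theta>. The mixed
  term s^(p-1) u^m z either lies below the energy, or is at most a multiple of z^p u^(m+p-1). Since
  \<alpha> > p - 1, that power of u is lower than u^(\<alpha>+m): it is absorbed, or else u itself
  is bounded by a power of z and a multiple of z^q remains. This is the origin of \<open>q\<close>;
  taking k \<ge> q pays for the division by \<theta>. Mollification is applied to the test function
  alone and the flux keeps the true weak gradient. The approximated gradients therefore enter
  linearly, and their convergence in L^p is paired with a flux of growth p - 1. A natural exponent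
  \<open>m\<close> keeps powers of the nonnegative mollified functions smooth and
  nonnegative.\<close>

text \<open>\<open>grad\<close> is a definite description, so computing it requires uniqueness,
  which is inherited from the Frechet derivative.\<close>

lemma grad_eq:
  assumes "(f has_derivative D) (at x)" and "\<And>h. D h = h \<bullet> d"
  shows "grad f x = d"
proof -
  have "GDERIV f x :> d"
    unfolding gderiv_def by (rule has_derivative_eq_rhs[OF assms(1)]) (use assms(2) in auto)
  moreover have "e = d" if "GDERIV f x :> e" for e
    using has_derivative_unique[OF that[unfolded gderiv_def] assms(1)] assms(2)
    by (metis inner_commute vector_eq_ldot)
  ultimately show ?thesis
    unfolding grad_def by (rule the_equality)
qed

text \<open>Riesz representation in coordinates: the vector with components \<open>D b\<close>
  represents the linear form \<open>D\<close>.\<close>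

lemma has_derivative_inner_grad:
  fixes f :: "'a::euclidean_space \<Rightarrow> real"
  assumes "(f has_derivative D) (at x)"
  shows "D h = grad f x \<bullet> h"
proof -
  interpret D: bounded_linear D using assms by (rule has_derivative_bounded_linear)
  let ?d = "\<Sum>b\<in>Basis. D b *\<^sub>R b"
  have *: "D v = v \<bullet> ?d" for v :: 'a
  proof -
    have "D v = D (\<Sum>b\<in>Basis. (v \<bullet> b) *\<^sub>R b)" by (simp add: euclidean_representation)
    also have "\<dots> = v \<bullet> ?d" by (simp add: D.sum D.scaleR inner_sum_right mult.commute)
    finally show ?thesis .
  qed
  have "grad f x = ?d" by (rule grad_eq[OF assms *])
  then show ?thesis using *[of h] by (simp only: inner_commute)
qed

lemma differentiable_frechet:
  assumes "f differentiable (at x)"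
  shows "(f has_derivative frechet_derivative f (at x)) (at x)"
  using assms frechet_derivative_works by blast

lemma frechet_derivative_eq_grad:
  fixes f :: "'a::euclidean_space \<Rightarrow> real"
  assumes "f differentiable (at x)"
  shows "frechet_derivative f (at x) h = grad f x \<bullet> h"
  using has_derivative_inner_grad[OF differentiable_frechet[OF assms]] .

lemma has_derivative_grad:
  fixes f :: "'a::euclidean_space \<Rightarrow> real"
  assumes "f differentiable (at x)"
  shows "(f has_derivative (\<lambda>v. grad f x \<bullet> v)) (at x)"
  by (rule has_derivative_eq_rhs[OF differentiable_frechet[OF assms]])
    (simp add: fun_eq_iff frechet_derivative_eq_grad[OF assms])

lemma C_diff_on_continuous:
  assumes "C_diff_on k f S" shows "continuous_on S f"
  using assms
  by (cases k) (auto intro!: continuous_at_imp_continuous_on differentiable_imp_continuous_within)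

lemma C_diff_on_SucD: "C_diff_on (Suc k) f S \<Longrightarrow> C_diff_on k f S"
proof (induction k arbitrary: f)
  case 0
  then show ?case using C_diff_on_continuous[of "Suc 0"] by simp
next
  case (Suc k)
  from Suc.prems have "\<forall>x\<in>S. f differentiable (at x)" "\<And>v. C_diff_on (Suc k) (\<lambda>x. frechet_derivative f (at x) v) S"
    by (auto simp only: C_diff_on.simps(2)[of "Suc k"])
  then show ?case by (simp only: C_diff_on.simps(2)[of k f]) (blast intro: Suc.IH)
qed

lemma continuous_on_grad:
  fixes f :: "'a::euclidean_space \<Rightarrow> real"
  assumes "C_diff_on (Suc k) f S"
  shows "continuous_on S (grad f)"
proof -
  have "continuous_on S (\<lambda>x. \<Sum>b\<in>Basis. frechet_derivative f (at x) b *\<^sub>R b)"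
    using assms by (intro continuous_intros) (auto intro: C_diff_on_continuous)
  moreover have "(\<Sum>b\<in>Basis. frechet_derivative f (at x) b *\<^sub>R b) = grad f x" if "x \<in> S" for x
    using assms that by (simp add: frechet_derivative_eq_grad euclidean_representation)
  ultimately show ?thesis by (simp cong: continuous_on_cong)
qed

section \<open>Algebra of smooth functions\<close>

abbreviation smooth :: "('a::real_normed_vector \<Rightarrow> real) \<Rightarrow> bool" where
  "smooth f \<equiv> \<forall>k. C_diff_on k f UNIV"

text \<open>Lets an explicit formula for the derivative replace \<open>frechet_derivative\<close>,
  so that the inductions below can be run on that formula.\<close>

lemma C_diff_on_SucI:
  assumes "\<And>x. (f has_derivative D x) (at x)" and "\<And>v. C_diff_on k (\<lambda>x. D x v) UNIV"
  shows "C_diff_on (Suc k) f UNIV"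
proof -
  have "frechet_derivative f (at x) = D x" for x
    using frechet_derivative_at[OF assms(1)] by simp
  then show ?thesis using assms by (auto simp: differentiable_def)
qed

lemma smooth_differentiable: "smooth f \<Longrightarrow> f differentiable (at x)"
  by (drule spec[of _ "Suc 0"]) simp

lemma smooth_frechet: "smooth f \<Longrightarrow> smooth (\<lambda>x. frechet_derivative f (at x) v)"
  by (intro allI, drule_tac x="Suc k" in spec) simp

lemma smooth_continuous: "smooth f \<Longrightarrow> continuous_on UNIV f"
  by (drule spec[of _ 0]) simp

lemma C_diff_on_const: "C_diff_on k (\<lambda>x. c) UNIV"
proof (induction k arbitrary: c)
  case (Suc k)
  show ?case by (rule C_diff_on_SucI[where D="\<lambda>_ _. 0"]) (auto intro: Suc)
qed simp

lemma C_diff_on_bounded_linear: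
  assumes "bounded_linear f" shows "C_diff_on k f UNIV"
proof (cases k)
  case 0
  then show ?thesis using assms by (simp add: linear_continuous_on)
next
  case (Suc k)
  show ?thesis unfolding Suc
    by (rule C_diff_on_SucI[where D="\<lambda>_. f"])
      (auto intro: C_diff_on_const bounded_linear_imp_has_derivative assms)
qed

lemma C_diff_on_add:
  "C_diff_on k f UNIV \<Longrightarrow> C_diff_on k g UNIV \<Longrightarrow> C_diff_on k (\<lambda>x. f x + g x) UNIV"
proof (induction k arbitrary: f g)
  case 0
  then show ?case by (auto intro: continuous_intros)
next
  case (Suc k)
  show ?case
    by (rule C_diff_on_SucI[where D="\<lambda>x v. frechet_derivative f (at x) v + frechet_derivative g (at x) v"])
      (use Suc in \<open>auto intro!: has_derivative_add differentiable_frechet\<close>)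
qed

lemma C_diff_on_mult:
  "C_diff_on k f UNIV \<Longrightarrow> C_diff_on k g UNIV \<Longrightarrow> C_diff_on k (\<lambda>x. f x * g x) UNIV"
proof (induction k arbitrary: f g)
  case 0
  then show ?case by (auto intro: continuous_intros)
next
  case (Suc k)
  show ?case
    by (rule C_diff_on_SucI[where D="\<lambda>x v. f x * frechet_derivative g (at x) v + frechet_derivative f (at x) v * g x"])
      \<comment> \<open>The product rule leaves one factor undifferentiated, and the induction
        hypothesis wants that factor only to order \<open>k\<close>.\<close>
      (use Suc C_diff_on_SucD[OF Suc.prems(1)] C_diff_on_SucD[OF Suc.prems(2)] in
        \<open>auto intro!: has_derivative_mult differentiable_frechet C_diff_on_add\<close>)
qed

lemma C_diff_on_power:
  "C_diff_on k f UNIV \<Longrightarrow> C_diff_on k (\<lambda>x. f x ^ m) UNIV"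
  by (induction m) (auto intro: C_diff_on_const C_diff_on_mult)

text \<open>The factors \<open>inverse t ^ j\<close> make the family closed under differentiation.\<close>

definition flat_exp :: "nat \<Rightarrow> real \<Rightarrow> real" where
  "flat_exp j t = (if t > 0 then exp (- inverse t) * inverse t ^ j else 0)"

lemma flat_exp_nonneg: "flat_exp j t \<ge> 0"
  by (simp add: flat_exp_def)

text \<open>On the right, y = 1/t turns the claim into the victory of the exponential over powers at
  infinity; on the left the function is zero. All derivatives of the gluing at 0 rest on this
  limit.\<close>

lemma flat_exp_tendsto_0: "(flat_exp j \<longlongrightarrow> 0) (at 0)"
proof -
  have "((\<lambda>y::real. y ^ j / exp y) \<longlongrightarrow> 0) at_top"
    by (rule tendsto_power_div_exp_0)
  then have "((\<lambda>t::real. inverse t ^ j / exp (inverse t)) \<longlongrightarrow> 0) (at_right 0)"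
    by (rule filterlim_compose[OF _ filterlim_inverse_at_top_right])
  then have "(flat_exp j \<longlongrightarrow> 0) (at_right 0)"
    by (rule Lim_transform_eventually)
      (auto simp: flat_exp_def exp_minus field_simps eventually_at_right_less intro!: eventually_at_rightI[of 0 1])
  moreover have "(flat_exp j \<longlongrightarrow> 0) (at_left 0)"
    by (rule Lim_transform_eventually[OF tendsto_const])
      (auto simp: flat_exp_def intro!: eventually_at_leftI[of "-1"])
  ultimately show ?thesis by (simp add: filterlim_at_split)
qed

lemma flat_exp_has_derivative:
  "(flat_exp j has_real_derivative (flat_exp (j + 2) t - j * flat_exp (Suc j) t)) (at t)"
proof -
  consider "t > 0" | "t = 0" | "t < 0" by linarith
  then show ?thesis
  proof cases
    case 1
    have "((\<lambda>t. exp (- inverse t) * inverse t ^ j) has_real_derivative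
       (exp (- inverse t) * (inverse t)\<^sup>2 * inverse t ^ j -
        j * (exp (- inverse t) * (inverse t ^ (j - Suc 0) * (inverse t)\<^sup>2)))) (at t)"
      using 1 by (auto intro!: derivative_eq_intros simp: power2_eq_square)
    moreover have "exp (- inverse t) * (inverse t)\<^sup>2 * inverse t ^ j -
        j * (exp (- inverse t) * (inverse t ^ (j - Suc 0) * (inverse t)\<^sup>2)) = flat_exp (j + 2) t - j * flat_exp (Suc j) t"
      using 1 by (cases j) (simp_all add: flat_exp_def power2_eq_square)
    ultimately have "((\<lambda>t. exp (- inverse t) * inverse t ^ j) has_real_derivative
       (flat_exp (j + 2) t - j * flat_exp (Suc j) t)) (at t)"
      by simp
    then show ?thesis
      by (rule has_field_derivative_transform_within_open[where S="{0<..}"])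
        (use 1 in \<open>auto simp: flat_exp_def\<close>)
  next
    case 2
    \<comment> \<open>Dividing by \<open>h\<close> only raises the index: the difference quotient at
      0 is \<open>flat_exp (Suc j) h\<close>, whose limit is already known.\<close>
    have "((\<lambda>h. flat_exp j h / h) \<longlongrightarrow> 0) (at 0)"
      by (rule Lim_transform_eventually[OF flat_exp_tendsto_0[of "Suc j"]])
        (auto simp: flat_exp_def field_simps)
    then show ?thesis using 2 by (simp add: DERIV_def flat_exp_def)
  next
    case 3
    have "((\<lambda>t. 0) has_real_derivative (flat_exp (j + 2) t - j * flat_exp (Suc j) t)) (at t)"
      using 3 by (simp add: flat_exp_def)
    then show ?thesis
      by (rule has_field_derivative_transform_within_open[where S="{..<0}"])
        (use 3 in \<open>auto simp: flat_exp_def\<close>)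
  qed
qed

text \<open>The derivative involves the indices \<open>j + 2\<close> and \<open>Suc j\<close>, hence
  the induction on the order \<open>k\<close> treats all \<open>j\<close> at once.\<close>

lemma C_diff_on_flat_exp:
  fixes q :: "'a::real_normed_vector \<Rightarrow> real"
  assumes "smooth q"
  shows "C_diff_on k (\<lambda>x. flat_exp j (q x)) UNIV"
proof (induction k arbitrary: j)
  case 0
  have "continuous_on UNIV (flat_exp j)"
    by (rule DERIV_continuous_on) (rule DERIV_subset[OF flat_exp_has_derivative], simp)
  then show ?case
    using continuous_on_compose2[OF _ smooth_continuous[OF assms], of UNIV "flat_exp j"] by simp
next
  case (Suc k)
  show ?case
  proof (rule C_diff_on_SucI)
    fix x
    show "((\<lambda>x. flat_exp j (q x)) has_derivative (\<lambda>v.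
        (flat_exp (j + 2) (q x) + (- j) * flat_exp (Suc j) (q x)) * frechet_derivative q (at x) v)) (at x)"
      using has_derivative_compose[OF differentiable_frechet[OF smooth_differentiable[OF assms]]
        flat_exp_has_derivative[of j, unfolded has_field_derivative_def]] by simp
  next
    fix v
    show "C_diff_on k (\<lambda>x. (flat_exp (j + 2) (q x) + (- j) * flat_exp (Suc j) (q x)) * frechet_derivative q (at x) v) UNIV"
      using smooth_frechet[OF assms] by (intro C_diff_on_mult C_diff_on_add C_diff_on_const Suc) blast
  qed
qed

text \<open>The squared norm, unlike the norm, is smooth at the origin; radial cut-offs are
  therefore composed with it.\<close>

lemma C_diff_on_quadratic: "C_diff_on k (\<lambda>x::'a::euclidean_space. a + b * (x \<bullet> x)) UNIV"
proof -
  have "smooth (\<lambda>x::'a. x \<bullet> x)"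
  proof
    fix k show "C_diff_on k (\<lambda>x::'a. x \<bullet> x) UNIV"
    proof (cases k)
      case 0 then show ?thesis by (auto intro!: continuous_intros)
    next
      case (Suc k)
      show ?thesis unfolding Suc
        by (rule C_diff_on_SucI[where D="\<lambda>x v. 2 * (x \<bullet> v)"])
          (auto intro!: derivative_eq_intros C_diff_on_bounded_linear bounded_linear_intros simp: inner_commute)
    qed
  qed
  then show ?thesis by (intro C_diff_on_add C_diff_on_mult C_diff_on_const) auto
qed

section \<open>Test functions and their supports\<close>

lemma test_function_smooth: "test_function f \<Longrightarrow> smooth f"
  by (simp add: test_function_def)

lemma test_functionI:
  fixes f :: "'a::euclidean_space \<Rightarrow> real"
  assumes "smooth f" and "\<And>x. norm x > r \<Longrightarrow> f x = 0"
  shows "test_function f"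
proof -
  have "{x. f x \<noteq> 0} \<subseteq> cball 0 r" using assms(2) by (force simp: not_le)
  then have "bounded {x. f x \<noteq> 0}" using bounded_subset bounded_cball by blast
  then show ?thesis using assms(1) by (simp add: test_function_def)
qed

text \<open>The radius is one larger than a bound for the support, so each point with norm at least
  \<open>r\<close> has a whole neighbourhood on which \<open>f\<close> vanishes. This is what makes
  the derivatives vanish there too.\<close>

lemma test_function_support:
  fixes f :: "'a::euclidean_space \<Rightarrow> real"
  assumes "test_function f"
  obtains r where "r > 0"
    and "\<forall>x. norm x \<ge> r \<longrightarrow> f x = 0 \<and> grad f x = 0 \<and> (\<forall>v. frechet_derivative f (at x) v = 0)"
proof -
  have "bounded (closure {x. f x \<noteq> 0})" using assms by (simp add: test_function_def compact_imp_bounded)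
  then obtain r where r: "r > 0" "\<And>x. x \<in> closure {x. f x \<noteq> 0} \<Longrightarrow> norm x \<le> r"
    by (auto simp: bounded_pos)
  have 1: "f x = 0" if "norm x \<ge> r + 1" for x
    using r(2)[of x] closure_subset[of "{x. f x \<noteq> 0}"] that by auto
  have d: "(f has_derivative (\<lambda>v. 0)) (at x)" if "norm x \<ge> r + 1" for x
  proof (rule has_derivative_transform_within_open[where f="\<lambda>_. 0" and s="- cball 0 r"])
    show "0 = f y" if "y \<in> - cball 0 r" for y
      using r(2)[of y] closure_subset[of "{x. f x \<noteq> 0}"] that by auto
  qed (use that in auto)
  have "f x = 0 \<and> grad f x = 0 \<and> (\<forall>v. frechet_derivative f (at x) v = 0)" if "norm x \<ge> r + 1" for x
    using 1[OF that] grad_eq[OF d[OF that], of 0] frechet_derivative_at[OF d[OF that]]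
    by (simp add: fun_eq_iff)
  with \<open>r > 0\<close> show ?thesis by (intro that[of "r + 1"]) auto
qed

lemma test_function_frechet:
  fixes f :: "'a::euclidean_space \<Rightarrow> real"
  assumes "test_function f" shows "test_function (\<lambda>x. frechet_derivative f (at x) v)"
proof -
  obtain r where "r > 0" and r: "\<forall>x. norm x \<ge> r \<longrightarrow> f x = 0 \<and> grad f x = 0 \<and> (\<forall>v. frechet_derivative f (at x) v = 0)"
    by (rule test_function_support[OF assms])
  show ?thesis
    by (rule test_functionI[where r=r], rule smooth_frechet, rule test_function_smooth, rule assms)
      (simp add: r)
qed

lemma test_function_mult:
  fixes f :: "'a::euclidean_space \<Rightarrow> real"
  assumes "test_function f" "smooth g" shows "test_function (\<lambda>x. g x * f x)"
proof -
  obtain r where "r > 0" and r: "\<forall>x. norm x \<ge> r \<longrightarrow> f x = 0 \<and> grad f x = 0 \<and> (\<forall>v. frechet_derivative f (at x) v = 0)"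
    by (rule test_function_support[OF assms(1)])
  show ?thesis
    by (rule test_functionI[where r=r])
      (use assms(2) test_function_smooth[OF assms(1)] in \<open>simp_all add: C_diff_on_mult r\<close>)
qed

text \<open>Inside the ball of radius r this is exp(-1/t) with t = 4 - 4 |x|^2 / r^2, and it is 0
  outside. The constant 4 gives t \<ge> 3 on the half ball, hence a lower bound there that does not
  depend on \<open>r\<close>.\<close>

definition bump :: "real \<Rightarrow> 'a::euclidean_space \<Rightarrow> real" where
  "bump r x = flat_exp 0 (4 - (2 / r)\<^sup>2 * (x \<bullet> x))"

lemma bump_eq_0: "r > 0 \<Longrightarrow> norm x \<ge> r \<Longrightarrow> bump r x = 0"
proof -
  assume r: "r > 0" "norm x \<ge> r"
  then have "r\<^sup>2 \<le> x \<bullet> x" by (simp add: power2_norm_eq_inner[symmetric])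
  then have "(2 / r)\<^sup>2 * r\<^sup>2 \<le> (2 / r)\<^sup>2 * (x \<bullet> x)" by (intro mult_left_mono) auto
  then show ?thesis using r by (simp add: bump_def flat_exp_def power_divide)
qed

lemma test_function_bump:
  assumes r: "r > 0" shows "test_function (bump r :: 'a::euclidean_space \<Rightarrow> real)"
proof -
  show ?thesis
  proof (rule test_functionI[where r=r])
    show "smooth (bump r :: 'a \<Rightarrow> real)"
      using C_diff_on_quadratic[of _ 4 "- (2/r)\<^sup>2"]
      by (auto simp: bump_def[abs_def] intro!: C_diff_on_flat_exp)
  qed (simp add: bump_eq_0[OF r])
qed

lemma bump_nonneg: "bump r x \<ge> 0" and bump_le_1: "bump r x \<le> 1"
  by (auto simp: bump_def flat_exp_def)

lemma bump_ge:
  assumes "r > 0" "norm x \<le> r / 2" shows "bump r x \<ge> exp (- (1/3))"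
proof -
  have "x \<bullet> x \<le> (r/2)\<^sup>2" using assms by (simp add: power2_norm_eq_inner[symmetric] power_mono)
  then have "(2 / r)\<^sup>2 * (x \<bullet> x) \<le> (2 / r)\<^sup>2 * (r/2)\<^sup>2" by (intro mult_left_mono) auto
  also have "\<dots> = 1" using assms by (simp add: field_simps)
  finally have "4 - (2 / r)\<^sup>2 * (x \<bullet> x) \<ge> 3" by simp
  then have "inverse (4 - (2 / r)\<^sup>2 * (x \<bullet> x)) \<le> 1/3" and "4 - (2 / r)\<^sup>2 * (x \<bullet> x) > 0"
    by (auto simp: field_simps)
  then show ?thesis by (simp add: bump_def flat_exp_def)
qed

text \<open>With y = 1/t the claim is y^2 / 2 \<le> exp y. This factor appears in the gradient of
  \<open>bump\<close>.\<close>

lemma flat_exp_2_le: "flat_exp 2 t \<le> 2"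
proof (cases "t > 0")
  case True
  have "(inverse t)\<^sup>2 / 2 \<le> exp (inverse t)"
    using exp_lower_Taylor_quadratic[of "inverse t"] positive_imp_inverse_positive[OF True] by linarith
  then show ?thesis using True by (simp add: flat_exp_def exp_minus divide_simps)
qed (simp add: flat_exp_def)

lemma grad_bump:
  fixes x :: "'a::euclidean_space"
  assumes "r > 0"
  shows "grad (bump r) x = (flat_exp 2 (4 - (2 / r)\<^sup>2 * (x \<bullet> x)) * (- (2 / r)\<^sup>2 * 2)) *\<^sub>R x"
proof (rule grad_eq)
  show "(bump r has_derivative (\<lambda>v. flat_exp 2 (4 - (2 / r)\<^sup>2 * (x \<bullet> x)) * (- (2 / r)\<^sup>2 * (2 * (x \<bullet> v))))) (at x)"
    unfolding bump_def[abs_def]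
    by (rule has_derivative_compose[OF _ flat_exp_has_derivative[of 0, unfolded has_field_derivative_def], THEN has_derivative_eq_rhs])
      (use assms in \<open>auto intro!: derivative_eq_intros simp: inner_commute numeral_2_eq_2\<close>)
qed (simp add: inner_commute)

lemma grad_bump_eq_0:
  assumes "r > 0" "norm x \<ge> r" shows "grad (bump r) x = 0"
proof -
  have "r\<^sup>2 \<le> x \<bullet> x" using assms by (simp add: power2_norm_eq_inner[symmetric])
  then have "(2 / r)\<^sup>2 * r\<^sup>2 \<le> (2 / r)\<^sup>2 * (x \<bullet> x)" by (intro mult_left_mono) auto
  then show ?thesis using assms by (simp add: grad_bump flat_exp_def power_divide)
qed

text \<open>Where norm x < r, the factors are at most 2 and (4 / r^2) * 2 * r, whose product is 16 /
  r. The decay in \<open>r\<close> is the source of the factor \<open>(16 / R) powr q\<close> in the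
  final estimate.\<close>

lemma norm_grad_bump_le:
  assumes "r > 0" shows "norm (grad (bump r) x) \<le> 16 / r"
proof (cases "norm x \<ge> r")
  case True
  then show ?thesis using assms by (simp add: grad_bump_eq_0)
next
  case False
  have "norm (grad (bump r) x) = flat_exp 2 (4 - (2 / r)\<^sup>2 * (x \<bullet> x)) * ((2 / r)\<^sup>2 * 2 * norm x)"
    by (simp add: grad_bump[OF assms] abs_mult flat_exp_nonneg)
  also have "\<dots> \<le> 2 * ((2 / r)\<^sup>2 * 2 * r)"
    using False by (intro mult_mono flat_exp_2_le) (auto simp: flat_exp_nonneg)
  also have "\<dots> = 16 / r" using assms by (simp add: field_simps power2_eq_square)
  finally show ?thesis .
qed

section \<open>Convolution with test functions\<close>

lemma integrable_lborel_compact_support: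
  fixes f :: "'a::euclidean_space \<Rightarrow> 'b::euclidean_space"
  assumes "continuous_on UNIV f" and "compact K" and "\<And>x. x \<notin> K \<Longrightarrow> f x = 0"
  shows "integrable lborel f"
proof -
  have "integrable lborel (\<lambda>x. indicator K x *\<^sub>R f x)"
    using assms by (intro borel_integrable_compact) (auto intro: continuous_on_subset)
  moreover have "(\<lambda>x. indicator K x *\<^sub>R f x) = f"
    using assms(3) by (auto simp: indicator_def)
  ultimately show ?thesis by simp
qed

text \<open>Passes to the gauge integral over a box, the form in which the Leibniz rule is applied
  below.\<close>

lemma integral_lborel_compact_support:
  fixes f :: "'a::euclidean_space \<Rightarrow> 'b::euclidean_space"
  assumes "continuous_on UNIV f" and "\<And>x. x \<notin> cbox a b \<Longrightarrow> f x = 0"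
  shows "integral\<^sup>L lborel f = integral (cbox a b) f"
proof -
  have eq: "(\<lambda>x. indicator (cbox a b) x *\<^sub>R f x) = f"
    using assms(2) by (auto simp: indicator_def)
  have "set_integrable lborel (cbox a b) f"
    unfolding set_integrable_def
    using assms by (intro borel_integrable_compact) (auto intro: continuous_on_subset)
  from set_borel_integral_eq_integral(2)[OF this] show ?thesis
    unfolding set_lebesgue_integral_def eq .
qed

definition conv :: "('a::euclidean_space \<Rightarrow> 'b::euclidean_space) \<Rightarrow> ('a \<Rightarrow> real) \<Rightarrow> 'a \<Rightarrow> 'b" where
  "conv f \<rho> x = (\<integral>y. \<rho> (x - y) *\<^sub>R f y \<partial>lborel)"

lemma conv_integrable:
  fixes f :: "'a::euclidean_space \<Rightarrow> 'b::euclidean_space"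
  assumes "continuous_on UNIV f" and "test_function \<rho>"
  shows "integrable lborel (\<lambda>y. \<rho> (x - y) *\<^sub>R f y)"
proof -
  obtain r where "r > 0" and r: "\<forall>x. norm x \<ge> r \<longrightarrow> \<rho> x = 0 \<and> grad \<rho> x = 0 \<and> (\<forall>v. frechet_derivative \<rho> (at x) v = 0)"
    by (rule test_function_support[OF assms(2)])
  have "continuous_on UNIV \<rho>" using assms(2) by (intro smooth_continuous test_function_smooth)
  then have "continuous_on UNIV (\<lambda>y. \<rho> (x - y))"
    by (rule continuous_on_compose2) (auto intro: continuous_intros)
  then show ?thesis
    by (intro integrable_lborel_compact_support[of _ "cball x r"] continuous_intros assms)
      (auto simp: r dist_norm)
qed

text \<open>Differentiation under the integral sign falls on the kernel, so continuity of
  \<open>u\<close> suffices. Near \<open>x0\<close> all the integrands are supported in one fixed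
  box, which turns the convolution into an integral over a compact set.\<close>

lemma conv_has_derivative:
  fixes u :: "'a::euclidean_space \<Rightarrow> real"
  assumes u: "continuous_on UNIV u" and \<rho>: "test_function \<rho>"
  shows "(conv u \<rho> has_derivative (\<lambda>v. conv u (\<lambda>z. frechet_derivative \<rho> (at z) v) x0)) (at x0)"
proof -
  obtain r where "r > 0" and r: "\<forall>x. norm x \<ge> r \<longrightarrow> \<rho> x = 0 \<and> grad \<rho> x = 0 \<and> (\<forall>v. frechet_derivative \<rho> (at x) v = 0)"
    by (rule test_function_support[OF \<rho>])
  \<comment> \<open>The extra 1 leaves room for \<open>x\<close> to move in the unit ball about
    \<open>x0\<close>: the kernel centred at such an \<open>x\<close> still vanishes off the
    box.\<close>
  obtain a where a: "cball x0 (r + 1) \<subseteq> cbox (- a) a"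
    using bounded_subset_cbox_symmetric[OF bounded_cball] by blast
  let ?K = "cbox (- a) a" and ?U = "ball x0 1"
  have out: "norm (x - y) \<ge> r" if "x \<in> ?U" "y \<notin> ?K" for x y
  proof -
    have "y \<notin> cball x0 (r + 1)" using that(2) a by blast
    then have "dist x0 y > r + 1" by simp
    moreover have "dist x0 x < 1" using that by simp
    ultimately have "dist x y > r" using dist_triangle[of x0 y x] by linarith
    then show ?thesis by (simp add: dist_norm)
  qed
  have sm: "smooth \<rho>" using \<rho> by (rule test_function_smooth)
  have c\<rho>: "continuous_on UNIV \<rho>" by (rule smooth_continuous[OF sm])
  have cD: "continuous_on UNIV (\<lambda>z. frechet_derivative \<rho> (at z) v)" for v
    by (rule smooth_continuous[OF smooth_frechet[OF sm]])
  have blin: "bounded_linear (frechet_derivative \<rho> (at z))" for z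
    using differentiable_frechet[OF smooth_differentiable[OF sm]] has_derivative_bounded_linear by blast
  have D: "(\<rho> has_derivative frechet_derivative \<rho> (at z)) (at z)" for z
    by (rule differentiable_frechet[OF smooth_differentiable[OF sm]])
  \<comment> \<open>The Leibniz rule asks for a derivative that is continuous as a family of bounded
    linear maps, hence the packaging as a \<open>blinfun\<close>; continuity is then checked on
    basis vectors.\<close>
  define fx where "fx x t = u t *\<^sub>R Blinfun (frechet_derivative \<rho> (at (x - t)))" for x t
  have fx: "blinfun_apply (fx x t) v = frechet_derivative \<rho> (at (x - t)) v *\<^sub>R u t" for x t v
    by (simp add: fx_def blinfun.scaleR_left bounded_linear_Blinfun_apply[OF blin])
  have cfx: "continuous_on UNIV (\<lambda>z. fx (fst z) (snd z))"
  proof (rule continuous_on_blinfun_componentwise)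
    fix i :: 'a
    show "continuous_on UNIV (\<lambda>z. blinfun_apply (fx (fst z) (snd z)) i)"
      unfolding fx
      by (intro continuous_intros continuous_on_compose2[OF cD, of _ "\<lambda>z. fst z - snd z"]
          continuous_on_compose2[OF u, of _ snd]) auto
  qed
  have cxy: "continuous_on S (\<lambda>y. \<rho> (x - y) *\<^sub>R u y)" for x S
    by (intro continuous_intros continuous_on_compose2[OF c\<rho>, of _ "\<lambda>y. x - y"]
        continuous_on_subset[OF u]) auto
  have leib: "((\<lambda>x. integral ?K (\<lambda>y. \<rho> (x - y) *\<^sub>R u y)) has_derivative
      blinfun_apply (integral ?K (fx x0))) (at x0 within ?U)"
  proof (rule leibniz_rule)
    show "((\<lambda>x. \<rho> (x - t) *\<^sub>R u t) has_derivative blinfun_apply (fx x t)) (at x within ?U)" for x t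
    proof -
      have "((\<lambda>x. \<rho> (x - t)) has_derivative (\<lambda>v. frechet_derivative \<rho> (at (x - t)) v)) (at x within ?U)"
        by (rule has_derivative_compose[OF _ D]) (auto intro!: derivative_eq_intros)
      then show ?thesis
        by (intro has_derivative_eq_rhs[OF has_derivative_scaleR_left]) (auto simp: fx fun_eq_iff)
    qed
    show "(\<lambda>y. \<rho> (x - y) *\<^sub>R u y) integrable_on ?K" for x
      by (intro integrable_continuous cxy)
    show "continuous_on (?U \<times> ?K) (\<lambda>(x, t). fx x t)"
      using continuous_on_subset[OF cfx] by (auto simp: case_prod_beta)
  qed auto
  have "blinfun_apply (integral ?K (fx x0)) v = conv u (\<lambda>z. frechet_derivative \<rho> (at z) v) x0" for v
  proof -
    have "continuous_on ?K (fx x0)"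
      using continuous_on_compose2[OF cfx, of ?K "\<lambda>t. (x0, t)"] by (simp add: continuous_intros)
    then have "blinfun_apply (integral ?K (fx x0)) v = integral ?K (\<lambda>t. fx x0 t v)"
      by (intro blinfun_apply_integral integrable_continuous)
    also have "\<dots> = conv u (\<lambda>z. frechet_derivative \<rho> (at z) v) x0"
      unfolding conv_def fx
    proof (rule integral_lborel_compact_support[symmetric])
      show "continuous_on UNIV (\<lambda>t. frechet_derivative \<rho> (at (x0 - t)) v *\<^sub>R u t)"
        by (intro continuous_intros continuous_on_compose2[OF cD, of _ "\<lambda>z. x0 - z"] u) auto
    qed (use r out in auto)
    finally show ?thesis .
  qed
  then have "blinfun_apply (integral ?K (fx x0)) = (\<lambda>v. conv u (\<lambda>z. frechet_derivative \<rho> (at z) v) x0)"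
    by (rule ext)
  with leib have "((\<lambda>x. integral ?K (\<lambda>y. \<rho> (x - y) *\<^sub>R u y)) has_derivative
      (\<lambda>v. conv u (\<lambda>z. frechet_derivative \<rho> (at z) v) x0)) (at x0)"
    using at_within_open[of x0 ?U] by simp
  then show ?thesis
  proof (rule has_derivative_transform_within_open[where s = ?U])
    fix x assume "x \<in> ?U"
    then show "integral ?K (\<lambda>y. \<rho> (x - y) *\<^sub>R u y) = conv u \<rho> x"
      unfolding conv_def using r out
      by (intro integral_lborel_compact_support[symmetric] cxy) auto
  qed auto
qed

text \<open>Each directional derivative is again a convolution of \<open>u\<close>, with another
  test function as kernel; hence the induction generalises over the kernel.\<close>

lemma C_diff_on_conv:
  fixes u :: "'a::euclidean_space \<Rightarrow> real"
  assumes "continuous_on UNIV u" and "test_function \<rho>"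
  shows "C_diff_on k (conv u \<rho>) UNIV"
  using assms(2)
proof (induction k arbitrary: \<rho>)
  case 0
  then show ?case
    using has_derivative_continuous[OF conv_has_derivative[OF assms(1) 0]]
    by (simp add: continuous_at_imp_continuous_on)
next
  case (Suc k)
  show ?case
    by (rule C_diff_on_SucI[OF conv_has_derivative[OF assms(1) Suc.prems]])
      (intro Suc.IH test_function_frechet Suc.prems)
qed

lemma C_diff_on_reflect:
  assumes "smooth \<rho>" shows "C_diff_on k (\<lambda>y. \<rho> (x - y)) UNIV"
  using assms
proof (induction k arbitrary: \<rho>)
  case 0
  show ?case
    using continuous_on_compose2[OF smooth_continuous[OF 0], of UNIV "\<lambda>y. x - y"]
    by (simp add: continuous_intros)
next
  case (Suc k)
  show ?case
  proof (rule C_diff_on_SucI)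
    show "((\<lambda>y. \<rho> (x - y)) has_derivative (\<lambda>v. frechet_derivative \<rho> (at (x - y)) (- v))) (at y)" for y
      by (rule has_derivative_compose[OF _ differentiable_frechet[OF smooth_differentiable[OF Suc.prems]]])
        (auto intro!: derivative_eq_intros)
    show "C_diff_on k (\<lambda>y. frechet_derivative \<rho> (at (x - y)) (- v)) UNIV" for v
      by (rule Suc.IH[OF smooth_frechet[OF Suc.prems]])
  qed
qed

lemma test_function_reflect:
  fixes \<rho> :: "'a::euclidean_space \<Rightarrow> real" and x y :: 'a
  assumes "test_function \<rho>"
  shows "test_function (\<lambda>y. \<rho> (x - y))" and "grad (\<lambda>y. \<rho> (x - y)) y = - grad \<rho> (x - y)"
proof -
  have sm: "smooth \<rho>" using assms by (rule test_function_smooth)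
  obtain r where "r > 0" and r: "\<forall>x. norm x \<ge> r \<longrightarrow> \<rho> x = 0 \<and> grad \<rho> x = 0 \<and> (\<forall>v. frechet_derivative \<rho> (at x) v = 0)"
    by (rule test_function_support[OF assms])
  show "test_function (\<lambda>y. \<rho> (x - y))"
  proof (rule test_functionI[where r="r + norm x"])
    fix y :: 'a assume "norm y > r + norm x"
    then have "norm (x - y) \<ge> r" using norm_triangle_ineq2[of y x] by (simp add: norm_minus_commute)
    then show "\<rho> (x - y) = 0" using r by simp
  qed (simp add: C_diff_on_reflect[OF sm])
  have "((\<lambda>y. \<rho> (x - y)) has_derivative (\<lambda>v. frechet_derivative \<rho> (at (x - y)) (- v))) (at y)"
    by (rule has_derivative_compose[OF _ differentiable_frechet[OF smooth_differentiable[OF sm]]])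
      (auto intro!: derivative_eq_intros)
  then show "grad (\<lambda>y. \<rho> (x - y)) y = - grad \<rho> (x - y)"
    by (rule grad_eq)
      (simp add: frechet_derivative_eq_grad[OF smooth_differentiable[OF sm]] inner_commute)
qed

text \<open>For fixed \<open>x\<close> the reflected kernel is itself an admissible test function.
  Its gradient carries a minus sign, which cancels the one in the definition of the weak
  gradient.\<close>

lemma grad_conv:
  fixes u :: "'a::euclidean_space \<Rightarrow> real"
  assumes u: "continuous_on UNIV u" and \<rho>: "test_function \<rho>"
    and G: "\<And>\<phi>. test_function \<phi> \<Longrightarrow> (\<integral>x. u x *\<^sub>R grad \<phi> x \<partial>lborel) = - (\<integral>x. \<phi> x *\<^sub>R G x \<partial>lborel)"
  shows "grad (conv u \<rho>) x = conv G \<rho> x"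
proof (rule grad_eq[OF conv_has_derivative[OF u \<rho>]])
  fix v
  have sm: "smooth \<rho>" using \<rho> by (rule test_function_smooth)
  obtain r where "r > 0" and r: "\<forall>x. norm x \<ge> r \<longrightarrow> \<rho> x = 0 \<and> grad \<rho> x = 0 \<and> (\<forall>v. frechet_derivative \<rho> (at x) v = 0)"
    by (rule test_function_support[OF \<rho>])
  have "continuous_on UNIV (grad \<rho>)" using continuous_on_grad sm by blast
  then have int: "integrable lborel (\<lambda>y. u y *\<^sub>R grad \<rho> (x - y))"
    by (intro integrable_lborel_compact_support[of _ "cball x r"] continuous_intros u
       continuous_on_compose2[of UNIV "grad \<rho>" _ "\<lambda>y. x - y"]) (auto simp: r dist_norm)
  have "conv u (\<lambda>z. frechet_derivative \<rho> (at z) v) x = (\<integral>y. (u y *\<^sub>R grad \<rho> (x - y)) \<bullet> v \<partial>lborel)"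
    by (simp add: conv_def frechet_derivative_eq_grad[OF smooth_differentiable[OF sm]] mult.commute)
  also have "\<dots> = (\<integral>y. u y *\<^sub>R grad \<rho> (x - y) \<partial>lborel) \<bullet> v"
    using int by (intro integral_inner_left)
  also have "(\<integral>y. u y *\<^sub>R grad \<rho> (x - y) \<partial>lborel) = conv G \<rho> x"
    using G[OF test_function_reflect(1)[OF \<rho>, of x]]
    by (simp add: test_function_reflect(2)[OF \<rho>] conv_def)
  finally show "conv u (\<lambda>z. frechet_derivative \<rho> (at z) v) x = v \<bullet> conv G \<rho> x"
    by (simp only: inner_commute)
qed

section \<open>Approximation in \<open>L\<^sup>p\<close>\<close>

text \<open>A convex function lies above its tangents. Convexity is invoked on the open half-line
  only, so zero arguments are split off; for a = 0 the left side is 0 because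
  \<open>0 powr z = 0\<close> for every \<open>z\<close>.\<close>

lemma powr_tangent_le:
  fixes a b p :: real
  assumes "p \<ge> 1" "a \<ge> 0" "b \<ge> 0"
  shows "a powr p + p * a powr (p - 1) * (b - a) \<le> b powr p"
proof -
  consider "a = 0" | "a > 0" "b = 0" | "a > 0" "b > 0" using assms by linarith
  then show ?thesis
  proof cases
    case 2
    have "p * a powr (p - 1) * a = p * a powr p"
      using 2 powr_mult_base[of a "p - 1"] by (simp add: mult.commute mult.assoc)
    moreover have "a powr p \<le> p * a powr p" using mult_right_mono[OF assms(1), of "a powr p"] by simp
    ultimately show ?thesis using 2 by (simp add: algebra_simps)
  next
    case 3
    have "b powr p - a powr p \<ge> (p * a powr (p - 1)) * (b - a)"
    proof (rule convex_on_imp_above_tangent[where A="{0<..}"])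
      show "convex_on {0<..} (\<lambda>x. x powr p)" by (rule powr_convex[OF assms(1)])
      show "((\<lambda>x. x powr p) has_real_derivative p * a powr (p - 1)) (at a within {0<..})"
        using 3 by (auto intro!: derivative_eq_intros)
    qed (use 3 in \<open>auto simp: interior_open\<close>)
    then show ?thesis by simp
  qed (use assms in auto)
qed

text \<open>The sum is at most three times its largest term, and the power of the largest term is
  one of the summands on the right.\<close>

lemma powr_add3_le:
  fixes a b c p :: real
  assumes "p \<ge> 0" "a \<ge> 0" "b \<ge> 0" "c \<ge> 0"
  shows "(a + b + c) powr p \<le> 3 powr p * (a powr p + b powr p + c powr p)"
proof -
  let ?m = "max a (max b c)"
  have "(a + b + c) powr p \<le> (3 * ?m) powr p" using assms by (intro powr_mono2) auto
  also have "\<dots> = 3 powr p * ?m powr p" using assms by (simp add: powr_mult)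
  also have "?m powr p \<le> a powr p + b powr p + c powr p"
    by (auto simp: max_def)
  finally show ?thesis by simp
qed

lemma le_one_plus_powr:
  fixes a p :: real
  assumes "p \<ge> 1" "a \<ge> 0" shows "a \<le> 1 + a powr p"
proof (cases "a \<le> 1")
  case False
  then have "a powr 1 \<le> a powr p" using assms by (intro powr_mono) auto
  then show ?thesis using False by simp
qed (simp add: add_increasing2)

lemma measurable_AE_limit_continuous:
  fixes f :: "'a::euclidean_space \<Rightarrow> 'b::euclidean_space"
  assumes "f \<in> borel_measurable borel"
  obtains g where "\<And>n::nat. continuous_on UNIV (g n)" and "AE x in lborel. (\<lambda>n. g n x) \<longlonglongrightarrow> f x"
proof -
  have "f \<in> borel_measurable lebesgue" using assms by (simp add: measurable_completion)
  then have "f measurable_on UNIV" by (intro lebesgue_measurable_imp_measurable_on) auto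
  \<comment> \<open>\<open>measurable_on\<close> means by definition being the limit of continuous
    functions off a negligible set.\<close>
  then obtain N g where N: "negligible N" and g: "\<And>n::nat. continuous_on UNIV (g n)"
    and lim: "\<And>x. x \<notin> N \<Longrightarrow> (\<lambda>n. g n x) \<longlonglongrightarrow> f x"
    unfolding measurable_on_def by auto
  have "AE x in lebesgue. x \<notin> N" using N by (intro AE_not_in) (simp add: negligible_iff_null_sets)
  then have "AE x in lborel. x \<notin> N" by (simp add: AE_completion_iff)
  then have "AE x in lborel. (\<lambda>n. g n x) \<longlonglongrightarrow> f x" by eventually_elim (rule lim)
  with g show ?thesis by (rule that)
qed

text \<open>Truncating the values of \<open>f\<close> to a large ball costs little by dominated
  convergence. Continuous functions converging to \<open>f\<close> almost everywhere, truncated in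
  the same way, are uniformly bounded, so a second dominated convergence on \<open>K\<close> applies
  to them.\<close>

lemma Lp_dense_continuous:
  fixes f :: "'a::euclidean_space \<Rightarrow> 'b::euclidean_space"
  assumes p: "p \<ge> 1" and [measurable]: "f \<in> borel_measurable borel" and K: "compact K"
    and int: "integrable lborel (\<lambda>x. indicator K x * norm (f x) powr p)" and e: "e > 0"
  obtains h where "continuous_on UNIV h"
    and "integrable lborel (\<lambda>x. indicator K x * norm (f x - h x) powr p)"
    and "(\<integral>x. indicator K x * norm (f x - h x) powr p \<partial>lborel) < e"
proof -
  have [measurable]: "K \<in> sets borel" using K by (simp add: borel_compact)
  \<comment> \<open>Truncation by nearest-point projection onto a ball is continuous, so composing
    it with continuous approximants keeps them continuous.\<close>
  define cl :: "nat \<Rightarrow> 'b \<Rightarrow> 'b" where "cl n = closest_point (cball 0 (real n))" for n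
  have cl_cont: "continuous_on UNIV (cl n)" for n
    unfolding cl_def by (rule continuous_on_closest_point) auto
  have [measurable]: "cl n \<in> borel_measurable borel" for n
    by (rule borel_measurable_continuous_onI[OF cl_cont])
  have cl_norm: "norm (cl n y) \<le> real n" for n y
    using closest_point_in_set[of "cball (0::'b) (real n)" y] by (auto simp: cl_def)
  have cl_self: "cl n y = y" if "norm y \<le> real n" for n y
    using that closest_point_self[of y "cball 0 (real n)"] by (auto simp: cl_def)
  have cl_le: "norm (cl n y) \<le> norm y" for n y
    using cl_norm[of n y] cl_self[of y n] by (cases "norm y \<le> real n") auto
  \<comment> \<open>Two errors of size \<open>e'\<close> are added, and the power of their sum costs
    a factor \<open>3 powr p\<close>.\<close>
  define e' where "e' = e / (2 * 3 powr p)"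
  have e': "e' > 0" using e by (simp add: e'_def)
  have "(\<lambda>n. \<integral>x. indicator K x * norm (f x - cl n (f x)) powr p \<partial>lborel) \<longlonglongrightarrow> integral\<^sup>L lborel (\<lambda>x::'a. 0)"
  proof (rule integral_dominated_convergence[where w="\<lambda>x. 2 powr p * (indicator K x * norm (f x) powr p)"])
    show "AE x in lborel. (\<lambda>n. indicator K x * norm (f x - cl n (f x)) powr p) \<longlonglongrightarrow> 0"
    proof (rule AE_I2, rule tendsto_eventually)
      fix x
      obtain N where "norm (f x) \<le> real N" using real_arch_simple by blast
      then show "\<forall>\<^sub>F n in sequentially. indicator K x * norm (f x - cl n (f x)) powr p = 0"
        by (intro eventually_sequentiallyI[of N]) (use cl_self p in auto)
    qed
    have "norm (f x - cl n (f x)) powr p \<le> 2 powr p * norm (f x) powr p" for x n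
    proof -
      have "norm (f x - cl n (f x)) \<le> 2 * norm (f x)"
        using norm_triangle_ineq4[of "f x" "cl n (f x)"] cl_le[of n "f x"] by linarith
      then have "norm (f x - cl n (f x)) powr p \<le> (2 * norm (f x)) powr p"
        using p by (intro powr_mono2) auto
      then show ?thesis by (simp add: powr_mult)
    qed
    then show "AE x in lborel. norm (indicator K x * norm (f x - cl n (f x)) powr p) \<le>
        2 powr p * (indicator K x * norm (f x) powr p)" for n
      by (intro AE_I2) (auto simp: indicator_def)
  qed (use int in auto)
  then have "\<forall>\<^sub>F n in sequentially. (\<integral>x. indicator K x * norm (f x - cl n (f x)) powr p \<partial>lborel) < e'"
    using e' by (intro order_tendstoD) auto
  then obtain n where n: "(\<integral>x. indicator K x * norm (f x - cl n (f x)) powr p \<partial>lborel) < e'"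
    by (meson eventually_happens trivial_limit_sequentially)
  obtain g where g: "\<And>k::nat. continuous_on UNIV (g k)" and lim: "AE x in lborel. (\<lambda>k. g k x) \<longlonglongrightarrow> f x"
    by (rule measurable_AE_limit_continuous[of f]) auto
  have [measurable]: "g k \<in> borel_measurable borel" for k
    by (rule borel_measurable_continuous_onI[OF g])
  have fin: "integrable lborel (indicator K :: 'a \<Rightarrow> real)"
    using K by (intro integrable_real_indicator) (use emeasure_bounded_finite[of K] compact_imp_bounded in auto)
  have bd: "norm (cl n y - cl n z) powr p \<le> (2 * real n) powr p" for y z
  proof (rule powr_mono2)
    show "norm (cl n y - cl n z) \<le> 2 * real n"
      using norm_triangle_ineq4[of "cl n y" "cl n z"] cl_norm[of n y] cl_norm[of n z] by linarith
  qed (use p in auto)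
  have int2: "integrable lborel (\<lambda>x. indicator K x * norm (cl n (f x) - cl n (g k x)) powr p)" for k
    by (rule Bochner_Integration.integrable_bound[OF integrable_mult_left[OF fin, of "(2 * real n) powr p"]])
      (use bd in \<open>auto simp: indicator_def\<close>)
  have "(\<lambda>k. \<integral>x. indicator K x * norm (cl n (f x) - cl n (g k x)) powr p \<partial>lborel) \<longlonglongrightarrow> integral\<^sup>L lborel (\<lambda>x::'a. 0)"
  proof (rule integral_dominated_convergence[where w="\<lambda>x. indicator K x * (2 * real n) powr p"])
    show "AE x in lborel. (\<lambda>k. indicator K x * norm (cl n (f x) - cl n (g k x)) powr p) \<longlonglongrightarrow> 0"
      using lim
    proof eventually_elim
      fix x assume "(\<lambda>k. g k x) \<longlonglongrightarrow> f x"
      then have "(\<lambda>k. cl n (g k x)) \<longlonglongrightarrow> cl n (f x)"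
        by (rule continuous_on_tendsto_compose[OF cl_cont]) auto
      then have "(\<lambda>k. norm (cl n (f x) - cl n (g k x))) \<longlonglongrightarrow> 0"
        using tendsto_norm[OF tendsto_diff[OF tendsto_const, of _ _ _ "cl n (f x)"]] by fastforce
      then have "(\<lambda>k. norm (cl n (f x) - cl n (g k x)) powr p) \<longlonglongrightarrow> 0 powr p"
        using p by (intro tendsto_powr') auto
      then show "(\<lambda>k. indicator K x * norm (cl n (f x) - cl n (g k x)) powr p) \<longlonglongrightarrow> 0"
        by (intro tendsto_mult_right_zero) auto
    qed
    show "AE x in lborel. norm (indicator K x * norm (cl n (f x) - cl n (g k x)) powr p) \<le>
        indicator K x * (2 * real n) powr p" for k
      using bd by (intro AE_I2) (auto simp: indicator_def)
  qed (use fin in auto)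
  then have "\<forall>\<^sub>F k in sequentially. (\<integral>x. indicator K x * norm (cl n (f x) - cl n (g k x)) powr p \<partial>lborel) < e'"
    using e' by (intro order_tendstoD) auto
  then obtain k where k: "(\<integral>x. indicator K x * norm (cl n (f x) - cl n (g k x)) powr p \<partial>lborel) < e'"
    by (meson eventually_happens trivial_limit_sequentially)
  let ?h = "\<lambda>x. cl n (g k x)"
  have int1: "integrable lborel (\<lambda>x. indicator K x * norm (f x - cl n (f x)) powr p)"
  proof (rule Bochner_Integration.integrable_bound[OF integrable_mult_right[OF int, of "2 powr p"]])
    have "norm (f x - cl n (f x)) powr p \<le> 2 powr p * norm (f x) powr p" for x
    proof -
      have "norm (f x - cl n (f x)) \<le> 2 * norm (f x)"
        using norm_triangle_ineq4[of "f x" "cl n (f x)"] cl_le[of n "f x"] by linarith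
      then have "norm (f x - cl n (f x)) powr p \<le> (2 * norm (f x)) powr p"
        using p by (intro powr_mono2) auto
      then show ?thesis by (simp add: powr_mult)
    qed
    then show "AE x in lborel. norm (indicator K x * norm (f x - cl n (f x)) powr p) \<le>
        norm (2 powr p * (indicator K x * norm (f x) powr p))"
      by (intro AE_I2) (auto simp: indicator_def)
  qed simp
  have sum: "indicator K x * norm (f x - ?h x) powr p \<le> 3 powr p *
      (indicator K x * norm (f x - cl n (f x)) powr p + indicator K x * norm (cl n (f x) - ?h x) powr p)" for x
  proof -
    \<comment> \<open>The third summand 0 only serves to reuse the inequality for three
      terms.\<close>
    have "norm (f x - ?h x) powr p \<le> (norm (f x - cl n (f x)) + norm (cl n (f x) - ?h x) + 0) powr p"
      using p norm_triangle_ineq[of "f x - cl n (f x)" "cl n (f x) - ?h x"] by (intro powr_mono2) auto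
    also have "\<dots> \<le> 3 powr p * (norm (f x - cl n (f x)) powr p + norm (cl n (f x) - ?h x) powr p + 0 powr p)"
      using p by (intro powr_add3_le) auto
    finally show ?thesis by (auto simp: indicator_def)
  qed
  have int3: "integrable lborel (\<lambda>x. 3 powr p * (indicator K x * norm (f x - cl n (f x)) powr p +
      indicator K x * norm (cl n (f x) - ?h x) powr p))"
    using int1 int2 by auto
  have inth: "integrable lborel (\<lambda>x. indicator K x * norm (f x - ?h x) powr p)"
    by (rule Bochner_Integration.integrable_bound[OF int3]) (auto intro!: AE_I2 order_trans[OF sum])
  have "(\<integral>x. indicator K x * norm (f x - ?h x) powr p \<partial>lborel) \<le>
     (\<integral>x. 3 powr p * (indicator K x * norm (f x - cl n (f x)) powr p +
      indicator K x * norm (cl n (f x) - ?h x) powr p) \<partial>lborel)"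
    using inth int3 sum by (intro integral_mono) auto
  also have "\<dots> = 3 powr p * ((\<integral>x. indicator K x * norm (f x - cl n (f x)) powr p \<partial>lborel) +
      (\<integral>x. indicator K x * norm (cl n (f x) - ?h x) powr p \<partial>lborel))"
    using int1 int2 by simp
  also have "\<dots> < 3 powr p * (e' + e')"
    using n k by (intro mult_strict_left_mono add_strict_mono) auto
  also have "\<dots> = e" by (simp add: e'_def)
  finally have "(\<integral>x. indicator K x * norm (f x - ?h x) powr p \<partial>lborel) < e" .
  moreover have "continuous_on UNIV ?h"
    by (rule continuous_on_compose2[OF cl_cont g]) auto
  ultimately show ?thesis using inth by (intro that)
qed

text \<open>Evenness is included so that the kernel \<open>\<rho> (x - y)\<close> has integral one
  in either variable: in \<open>y\<close> for averaging and Jensen, in \<open>x\<close> after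
  Fubini.\<close>

definition mollifier :: "real \<Rightarrow> ('a::euclidean_space \<Rightarrow> real) \<Rightarrow> bool" where
  "mollifier s \<rho> \<longleftrightarrow> test_function \<rho> \<and> (\<forall>x. \<rho> x \<ge> 0) \<and> (\<forall>x. norm x \<ge> s \<longrightarrow> \<rho> x = 0) \<and>
     (\<forall>x. \<rho> (- x) = \<rho> x) \<and> (\<integral>x. \<rho> x \<partial>lborel) = 1"

lemma test_function_continuous: "test_function f \<Longrightarrow> continuous_on UNIV f"
  using smooth_continuous test_function_smooth by blast

lemma test_function_integrable:
  fixes f :: "'a::euclidean_space \<Rightarrow> real"
  assumes "test_function f" shows "integrable lborel f"
proof -
  obtain r where "r > 0" and r: "\<forall>x. norm x \<ge> r \<longrightarrow> f x = 0 \<and> grad f x = 0 \<and> (\<forall>v. frechet_derivative f (at x) v = 0)"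
    by (rule test_function_support[OF assms])
  then show ?thesis
    by (intro integrable_lborel_compact_support[of _ "cball 0 r"] test_function_continuous assms) auto
qed

text \<open>The function \<open>bump s\<close> is divided by its integral, which is positive because
  of the uniform lower bound on the half ball.\<close>

lemma mollifier_exists:
  assumes "s > 0"
  obtains \<rho> :: "'a::euclidean_space \<Rightarrow> real" where "mollifier s \<rho>"
proof -
  let ?b = "bump s :: 'a \<Rightarrow> real"
  have int: "integrable lborel ?b"
    by (intro test_function_integrable test_function_bump assms)
  have "0 < exp (- (1/3)) * measure lborel (cball (0::'a) (s / 2))"
    using assms content_cball_pos[of "s/2" "0::'a"] by simp
  also have "\<dots> = (\<integral>x. exp (- (1/3)) * indicator (cball (0::'a) (s / 2)) x \<partial>lborel)"
    by simp
  also have "\<dots> \<le> (\<integral>x. ?b x \<partial>lborel)"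
  proof (rule integral_mono[OF _ int])
    show "integrable lborel (\<lambda>x. exp (- (1/3)) * indicator (cball (0::'a) (s / 2)) x :: real)"
      by (intro integrable_mult_right integrable_real_indicator)
        (use emeasure_bounded_finite[of "cball (0::'a) (s / 2)"] in auto)
  qed (use bump_ge[OF assms] bump_nonneg in \<open>auto simp: indicator_def\<close>)
  finally have pos: "(\<integral>x. ?b x \<partial>lborel) > 0" .
  show ?thesis
  proof (rule that)
    have "?b (- x) = ?b x" for x by (simp add: bump_def)
    then show "mollifier s (\<lambda>x. inverse (\<integral>x. ?b x \<partial>lborel) * ?b x)"
      unfolding mollifier_def
      using pos bump_nonneg bump_eq_0[OF assms] int
      by (auto intro!: test_function_mult test_function_bump assms C_diff_on_const mult_nonneg_nonneg)
  qed
qed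

context
  fixes s :: real and \<rho> :: "'a::euclidean_space \<Rightarrow> real"
  assumes \<rho>: "mollifier s \<rho>"
begin

lemma mollifier_test: "test_function \<rho>" and mollifier_nonneg: "\<rho> x \<ge> 0"
  and mollifier_support: "norm x \<ge> s \<Longrightarrow> \<rho> x = 0"
  using \<rho> by (auto simp: mollifier_def)

lemma mollifier_cont: "continuous_on UNIV \<rho>"
  using mollifier_test by (rule test_function_continuous)

lemma mollifier_measurable [measurable]: "\<rho> \<in> borel_measurable borel"
  using mollifier_cont by (rule borel_measurable_continuous_onI)

lemma mollifier_commute: "\<rho> (x - y) = \<rho> (y - x)"
  using \<rho> by (metis mollifier_def minus_diff_eq)

lemma mollifier_has_integral_left: "has_bochner_integral lborel (\<lambda>x. \<rho> (x - y)) 1"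
proof -
  have "integrable (distr lborel borel ((+) (- y))) \<rho>"
    using mollifier_test by (simp add: lborel_distr_plus test_function_integrable)
  then have "integrable lborel (\<lambda>x. \<rho> (- y + x))" by (subst (asm) integrable_distr_eq) auto
  moreover have "(\<integral>x. \<rho> (- y + x) \<partial>lborel) = (\<integral>x. \<rho> x \<partial>distr lborel borel ((+) (- y)))"
    by (subst integral_distr) auto
  then have "(\<integral>x. \<rho> (- y + x) \<partial>lborel) = 1" using \<rho> by (simp add: lborel_distr_plus mollifier_def)
  ultimately show ?thesis by (simp add: has_bochner_integral_iff)
qed

lemma mollifier_has_integral_right: "has_bochner_integral lborel (\<lambda>y. \<rho> (x - y)) 1"
  using mollifier_has_integral_left[of x] by (simp add: mollifier_commute[of x])

lemma mollifier_bounded: obtains B where "B \<ge> 0" "\<And>x. \<rho> x \<le> B"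
proof -
  have "bounded (\<rho> ` cball 0 s)"
    by (intro compact_imp_bounded compact_continuous_image continuous_on_subset[OF mollifier_cont]) auto
  then obtain B where B: "B > 0" "\<forall>x\<in>cball 0 s. \<bar>\<rho> x\<bar> \<le> B" by (auto simp: bounded_pos)
  have "\<rho> x \<le> B" for x
    using B mollifier_support[of x] by (cases "norm x \<ge> s") (auto simp: abs_le_iff)
  with B(1) show ?thesis by (intro that[of B]) auto
qed

text \<open>\<open>conv h \<rho> x\<close> is a weighted mean of values of \<open>h\<close> at
  distance below \<open>s\<close> from \<open>x\<close>, so its error is at most the oscillation
  there.\<close>

lemma conv_dist_le:
  fixes h :: "'a \<Rightarrow> 'b::euclidean_space"
  assumes h: "continuous_on UNIV h" and e: "\<And>y. dist x y < s \<Longrightarrow> dist (h x) (h y) \<le> e"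
  shows "norm (conv h \<rho> x - h x) \<le> e"
proof -
  note int = conv_integrable[OF h mollifier_test, of x]
  note one = mollifier_has_integral_right[of x]
  have i1: "integrable lborel (\<lambda>y. \<rho> (x - y) *\<^sub>R h x)" and e1: "(\<integral>y. \<rho> (x - y) *\<^sub>R h x \<partial>lborel) = h x"
    using has_bochner_integral_scaleR_left[OF one, of "h x"] by (auto simp: has_bochner_integral_iff)
  have "conv h \<rho> x - h x = (\<integral>y. \<rho> (x - y) *\<^sub>R h y - \<rho> (x - y) *\<^sub>R h x \<partial>lborel)"
    unfolding conv_def using int i1 e1 by simp
  also have "norm \<dots> \<le> (\<integral>y. \<rho> (x - y) * e \<partial>lborel)"
  proof (rule Bochner_Integration.integral_norm_bound_integral)
    show "norm (\<rho> (x - y) *\<^sub>R h y - \<rho> (x - y) *\<^sub>R h x) \<le> \<rho> (x - y) * e" for y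
    proof (cases "dist x y < s")
      case True
      then show ?thesis using e[OF True] mollifier_nonneg[of "x - y"]
        by (simp add: scaleR_diff_right[symmetric] dist_norm norm_minus_commute mult_left_mono)
    next
      case False
      then show ?thesis using mollifier_support[of "x - y"] by (simp add: dist_norm)
    qed
  qed (use int i1 one in \<open>auto simp: has_bochner_integral_iff\<close>)
  also have "\<dots> = e" using one by (simp add: has_bochner_integral_iff)
  finally show ?thesis .
qed

text \<open>The kernel is bounded, which settles the p-th power; the first power follows from t
  \<le> 1 + t^p, the constant 1 being integrable against the kernel.\<close>

lemma conv_integrable_Lp:
  fixes r :: "'a \<Rightarrow> 'b::euclidean_space"
  assumes p: "p \<ge> 1" and [measurable]: "r \<in> borel_measurable borel"
    and int: "integrable lborel (\<lambda>x. norm (r x) powr p)"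
  shows "integrable lborel (\<lambda>y. \<rho> (x - y) * norm (r y) powr p)"
    and "integrable lborel (\<lambda>y. \<rho> (x - y) *\<^sub>R r y)"
proof -
  obtain B where B: "B \<ge> 0" "\<And>x. \<rho> x \<le> B" by (rule mollifier_bounded) blast
  show 1: "integrable lborel (\<lambda>y. \<rho> (x - y) * norm (r y) powr p)"
    by (rule Bochner_Integration.integrable_bound[OF integrable_mult_right[OF int, of B]])
      (use B mollifier_nonneg in \<open>auto intro!: mult_right_mono\<close>)
  have "integrable lborel (\<lambda>y. \<rho> (x - y) + \<rho> (x - y) * norm (r y) powr p)"
    using 1 mollifier_has_integral_right[of x] by (auto simp: has_bochner_integral_iff)
  then show "integrable lborel (\<lambda>y. \<rho> (x - y) *\<^sub>R r y)"
  proof (rule Bochner_Integration.integrable_bound)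
    have "\<rho> (x - y) * norm (r y) \<le> \<rho> (x - y) * (1 + norm (r y) powr p)" for y
      by (intro mult_left_mono le_one_plus_powr p mollifier_nonneg) auto
    then show "AE y in lborel. norm (\<rho> (x - y) *\<^sub>R r y) \<le> norm (\<rho> (x - y) + \<rho> (x - y) * norm (r y) powr p)"
      using mollifier_nonneg by (intro AE_I2) (simp add: abs_of_nonneg algebra_simps)
  qed simp
qed

text \<open>Jensen's inequality, read off from the tangent of \<open>t \<mapsto> t powr p\<close> at the average.\<close>

lemma norm_conv_powr_le:
  fixes r :: "'a \<Rightarrow> 'b::euclidean_space"
  assumes p: "p \<ge> 1" and [measurable]: "r \<in> borel_measurable borel"
    and int: "integrable lborel (\<lambda>x. norm (r x) powr p)"
  shows "norm (conv r \<rho> x) powr p \<le> (\<integral>y. \<rho> (x - y) * norm (r y) powr p \<partial>lborel)"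
proof -
  note i = conv_integrable_Lp[OF p _ int, of x]
  define a where "a = (\<integral>y. \<rho> (x - y) * norm (r y) \<partial>lborel)"
  have i2: "integrable lborel (\<lambda>y. \<rho> (x - y) * norm (r y))"
    using integrable_norm[OF i(2)] mollifier_nonneg by (simp add: abs_of_nonneg)
  have one: "integrable lborel (\<lambda>y. \<rho> (x - y))" "(\<integral>y. \<rho> (x - y) \<partial>lborel) = 1"
    using mollifier_has_integral_right[of x] by (auto simp: has_bochner_integral_iff)
  have a0: "a \<ge> 0" unfolding a_def by (intro Bochner_Integration.integral_nonneg) (simp add: mollifier_nonneg)
  have "norm (conv r \<rho> x) \<le> a"
    unfolding conv_def a_def
    using integral_norm_bound[of lborel "\<lambda>y. \<rho> (x - y) *\<^sub>R r y"] mollifier_nonneg by (simp add: abs_of_nonneg)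
  then have "norm (conv r \<rho> x) powr p \<le> a powr p" using p by (intro powr_mono2) auto
  also have "a powr p = (\<integral>y. (a powr p - p * a powr (p - 1) * a) * \<rho> (x - y) + p * a powr (p - 1) * (\<rho> (x - y) * norm (r y)) \<partial>lborel)"
    using one i2 by (simp add: a_def[symmetric])
  also have "\<dots> \<le> (\<integral>y. \<rho> (x - y) * norm (r y) powr p \<partial>lborel)"
  proof (rule integral_mono)
    show "(a powr p - p * a powr (p - 1) * a) * \<rho> (x - y) + p * a powr (p - 1) * (\<rho> (x - y) * norm (r y))
       \<le> \<rho> (x - y) * norm (r y) powr p" for y
      using mult_left_mono[OF powr_tangent_le[OF p a0, of "norm (r y)"] mollifier_nonneg[of "x - y"]]
      by (simp add: algebra_simps)
  qed (use one i2 i in auto)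
  finally show ?thesis .
qed

lemma conv_measurable:
  fixes r :: "'a \<Rightarrow> 'b::euclidean_space"
  assumes [measurable]: "r \<in> borel_measurable borel"
  shows "conv r \<rho> \<in> borel_measurable borel"
proof -
  have "(\<lambda>x. \<integral>y. \<rho> (x - y) *\<^sub>R r y \<partial>lborel) \<in> borel_measurable lborel"
    by (rule lborel.borel_measurable_lebesgue_integral) simp
  then show ?thesis by (simp add: conv_def[abs_def])
qed

text \<open>Jensen's inequality pointwise, then Fubini. Working with nonnegative integrals up to the
  last step yields integrability and the bound together.\<close>

lemma conv_Lp_le:
  fixes r :: "'a \<Rightarrow> 'b::euclidean_space"
  assumes p: "p \<ge> 1" and [measurable]: "r \<in> borel_measurable borel"
    and int: "integrable lborel (\<lambda>x. norm (r x) powr p)"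
  shows "integrable lborel (\<lambda>x. norm (conv r \<rho> x) powr p)"
    and "(\<integral>x. norm (conv r \<rho> x) powr p \<partial>lborel) \<le> (\<integral>x. norm (r x) powr p \<partial>lborel)"
proof -
  note [measurable] = conv_measurable
  have "(\<integral>\<^sup>+x. norm (conv r \<rho> x) powr p \<partial>lborel) \<le> (\<integral>\<^sup>+x. (\<integral>y. \<rho> (x - y) * norm (r y) powr p \<partial>lborel) \<partial>lborel)"
    by (intro nn_integral_mono ennreal_leI norm_conv_powr_le p int) simp
  also have "\<dots> = (\<integral>\<^sup>+x. \<integral>\<^sup>+y. \<rho> (x - y) * norm (r y) powr p \<partial>lborel \<partial>lborel)"
    by (intro nn_integral_cong nn_integral_eq_integral[symmetric] conv_integrable_Lp p int)
      (auto simp: mollifier_nonneg)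
  also have "\<dots> = (\<integral>\<^sup>+y. \<integral>\<^sup>+x. \<rho> (x - y) * norm (r y) powr p \<partial>lborel \<partial>lborel)"
    by (rule lborel_pair.Fubini') simp
  also have "\<dots> = (\<integral>\<^sup>+y. norm (r y) powr p \<partial>lborel)"
  proof (rule nn_integral_cong)
    fix y
    have "(\<integral>\<^sup>+x. \<rho> (x - y) * norm (r y) powr p \<partial>lborel) = (\<integral>x. \<rho> (x - y) * norm (r y) powr p \<partial>lborel)"
      using mollifier_has_integral_left[of y]
      by (intro nn_integral_eq_integral) (auto simp: has_bochner_integral_iff mollifier_nonneg)
    then show "(\<integral>\<^sup>+x. \<rho> (x - y) * norm (r y) powr p \<partial>lborel) = norm (r y) powr p"
      using mollifier_has_integral_left[of y] by (simp add: has_bochner_integral_iff)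
  qed
  also have "\<dots> = (\<integral>x. norm (r x) powr p \<partial>lborel)"
    by (rule nn_integral_eq_integral[OF int]) simp
  finally have le: "(\<integral>\<^sup>+x. norm (conv r \<rho> x) powr p \<partial>lborel) \<le> ennreal (\<integral>x. norm (r x) powr p \<partial>lborel)" .
  show i: "integrable lborel (\<lambda>x. norm (conv r \<rho> x) powr p)"
    by (rule integrableI_nonneg) (use le in \<open>auto simp: top.not_eq_extremum intro: le_less_trans\<close>)
  show "(\<integral>x. norm (conv r \<rho> x) powr p \<partial>lborel) \<le> (\<integral>x. norm (r x) powr p \<partial>lborel)"
    using le nn_integral_eq_integral[OF i] by (simp add: Bochner_Integration.integral_nonneg)
qed

end

section \<open>Testing with powers of the solution\<close>

text \<open>A form of Young's inequality with free parameter \<open>l\<close>: according to whether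
  b \<le> l a, one of the two terms on the right already dominates.\<close>

lemma powr_Young:
  fixes a b l p :: real
  assumes "p \<ge> 1" "a \<ge> 0" "b \<ge> 0" "l > 0"
  shows "a powr (p - 1) * b \<le> l * a powr p + l powr (1 - p) * b powr p"
proof (cases "b \<le> l * a")
  case True
  have "a powr (p - 1) * b \<le> a powr (p - 1) * (l * a)" using True by (intro mult_left_mono) auto
  also have "\<dots> = l * a powr p"
    using assms powr_mult_base[of a "p - 1"] by (simp add: mult_ac)
  finally show ?thesis by (simp add: add_increasing2)
next
  case False
  then have "a \<le> b / l" using assms by (simp add: field_simps)
  then have "a powr (p - 1) * b \<le> (b / l) powr (p - 1) * b"
    using assms by (intro mult_right_mono powr_mono2) auto
  also have "\<dots> = l powr (1 - p) * b powr p"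
    using assms powr_mult_base[of b "p - 1"] powr_minus_divide[of l "p - 1"]
    by (simp add: powr_divide mult_ac)
  finally show ?thesis using assms by (simp add: add_increasing)
qed

lemma test_function_bounded:
  fixes \<eta> :: "'a::euclidean_space \<Rightarrow> real"
  assumes "test_function \<eta>"
  obtains R B where "R > 0" and "B \<ge> 1" and "\<forall>x. \<bar>\<eta> x\<bar> \<le> B \<and> norm (grad \<eta> x) \<le> B"
    and "\<forall>x. norm x > R \<longrightarrow> \<eta> x = 0 \<and> grad \<eta> x = 0"
proof -
  obtain R where R: "R > 0" and r: "\<forall>x. norm x \<ge> R \<longrightarrow> \<eta> x = 0 \<and> grad \<eta> x = 0 \<and> (\<forall>v. frechet_derivative \<eta> (at x) v = 0)"
    by (rule test_function_support[OF assms])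
  have "continuous_on UNIV (grad \<eta>)"
    by (intro continuous_on_grad[of 0] spec[OF test_function_smooth[OF assms]])
  then have "bounded (grad \<eta> ` cball 0 R)" "bounded (\<eta> ` cball 0 R)"
    by (auto intro!: compact_imp_bounded compact_continuous_image
        intro: continuous_on_subset test_function_continuous[OF assms])
  then obtain B1 B2 where B: "\<forall>x\<in>cball 0 R. norm (grad \<eta> x) \<le> B1" "\<forall>x\<in>cball 0 R. \<bar>\<eta> x\<bar> \<le> B2"
    by (auto simp: bounded_iff)
  have "\<bar>\<eta> x\<bar> \<le> max 1 (max B1 B2)" "norm (grad \<eta> x) \<le> max 1 (max B1 B2)" for x
    using B r by (cases "norm x \<le> R"; simp add: le_max_iff_disj)+
  then show ?thesis using R r by (intro that[of R "max 1 (max B1 B2)"]) auto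
qed

text \<open>Replaces the anisotropic flux by a Borel field \<open>A\<close> with growth p - 1 and
  coercivity, and the chosen weak gradient by a Borel representative \<open>G\<close>. The latter
  makes the integrands of the convolutions Borel on the product space, as Fubini demands.\<close>

locale coercive_subsolution =
  fixes u :: "'a::euclidean_space \<Rightarrow> real" and G A :: "'a \<Rightarrow> 'a" and p \<alpha> C c :: real
  assumes p: "p > 1" and c: "c > 0"
    and u_cont: "continuous_on UNIV u" and u_pos: "u x > 0"
    and G_measurable [measurable]: "G \<in> borel_measurable borel"
    and G_Lp: "compact K \<Longrightarrow> integrable lborel (\<lambda>x. indicator K x * norm (G x) powr p)"
    and weak_gradient: "test_function \<phi> \<Longrightarrow>
      (\<integral>x. u x *\<^sub>R grad \<phi> x \<partial>lborel) = - (\<integral>x. \<phi> x *\<^sub>R G x \<partial>lborel)"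
    and A_measurable [measurable]: "A \<in> borel_measurable borel"
    and A_le: "norm (A \<xi>) \<le> C * norm \<xi> powr (p - 1)"
    and A_coercive: "c * norm \<xi> powr p \<le> A \<xi> \<bullet> \<xi>"
    and subsolution: "test_function \<phi> \<Longrightarrow> (\<And>x. \<phi> x \<ge> 0) \<Longrightarrow>
      (\<integral>x. A (G x) \<bullet> grad \<phi> x \<partial>lborel) \<le> - (\<integral>x. u x powr \<alpha> * \<phi> x \<partial>lborel)"
begin

lemma u_measurable [measurable]: "u \<in> borel_measurable borel"
  using u_cont by (rule borel_measurable_continuous_onI)

lemma C_nonneg: "C \<ge> 0"
proof -
  obtain b :: 'a where "b \<in> Basis" using nonempty_Basis by blast
  then have "0 \<le> C * norm b powr (p - 1)" using order_trans[OF norm_ge_zero A_le] by blast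
  then show ?thesis using \<open>b \<in> Basis\<close> by simp
qed

text \<open>On a slightly larger ball, \<open>G\<close> is a continuous \<open>h\<close> plus a
  remainder small in L^p. Mollifying does not increase the norm of the remainder, and it moves
  \<open>h\<close> little by uniform continuity. The function found is a mollification of
  \<open>u\<close>, hence nonnegative and uniformly close to \<open>u\<close> on the ball.\<close>

lemma smooth_approximation:
  assumes R: "R > 0" and e: "e > 0"
  shows "\<exists>w. smooth w \<and> (\<forall>x. w x \<ge> 0) \<and> (\<forall>x. norm x \<le> R \<longrightarrow> \<bar>w x - u x\<bar> \<le> e) \<and>
    integrable lborel (\<lambda>x. indicator (cball 0 R) x * norm (grad w x - G x) powr p) \<and>
    (\<integral>x. indicator (cball 0 R) x * norm (grad w x - G x) powr p \<partial>lborel) \<le> e"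
proof -
  let ?K = "cball (0::'a) R" and ?L = "cball (0::'a) (R + 1)"
  define V where "V = measure lborel ?K"
  have V: "V \<ge> 0" by (simp add: V_def)
  \<comment> \<open>Three errors of size \<open>e1\<close> are collected: the remainder, its
    mollification, and the change of \<open>h\<close>. The power of a sum of three contributes
    \<open>3 powr p\<close>.\<close>
  define e1 where "e1 = e / (3 * 3 powr p)"
  have e1: "e1 > 0" using e by (simp add: e1_def)
  \<comment> \<open>A uniform error \<open>e2\<close> on a ball of volume \<open>V\<close> costs
    \<open>V * e2 powr p\<close> in the integral; \<open>V + 1\<close> keeps the denominator
    positive.\<close>
  define e2 where "e2 = (e1 / (V + 1)) powr (1 / p)"
  have e2: "e2 > 0" using e1 V by (simp add: e2_def)
  have e2p: "V * e2 powr p \<le> e1"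
  proof -
    have "e2 powr p = e1 / (V + 1)" using p e1 V by (simp add: e2_def powr_powr)
    then have "(V + 1) * e2 powr p = e1" using V by simp
    moreover have "V * e2 powr p \<le> (V + 1) * e2 powr p" by (intro mult_right_mono) auto
    ultimately show ?thesis by linarith
  qed
  obtain h where h: "continuous_on UNIV h"
    and hi: "integrable lborel (\<lambda>x. indicator ?L x * norm (G x - h x) powr p)"
    and hle: "(\<integral>x. indicator ?L x * norm (G x - h x) powr p \<partial>lborel) < e1"
    by (rule Lp_dense_continuous[OF _ _ compact_cball G_Lp[OF compact_cball] e1]) (use p in auto)
  have [measurable]: "h \<in> borel_measurable borel" using h by (rule borel_measurable_continuous_onI)
  have uh: "uniformly_continuous_on ?L h" and uu: "uniformly_continuous_on ?L u"
    by (intro compact_uniformly_continuous continuous_on_subset[OF h] continuous_on_subset[OF u_cont]; simp)+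
  obtain d1 where d1: "d1 > 0" "\<forall>x\<in>?L. \<forall>y\<in>?L. dist y x < d1 \<longrightarrow> dist (h y) (h x) < e2"
    using uh e2 unfolding uniformly_continuous_on_def by blast
  obtain d2 where d2: "d2 > 0" "\<forall>x\<in>?L. \<forall>y\<in>?L. dist y x < d2 \<longrightarrow> dist (u y) (u x) < e"
    using uu e unfolding uniformly_continuous_on_def by blast
  define s where "s = min 1 (min d1 d2)"
  have s: "s > 0" "s \<le> 1" "s \<le> d1" "s \<le> d2" using d1(1) d2(1) by (auto simp: s_def)
  obtain \<rho> :: "'a \<Rightarrow> real" where \<rho>: "mollifier s \<rho>" by (rule mollifier_exists[OF s(1)])
  note test = mollifier_test[OF \<rho>]
  have near: "x \<in> ?L" "y \<in> ?L" if "norm x \<le> R" "dist x y < s" for x y :: 'a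
    using that s(2) norm_triangle_ineq2[of y x] by (auto simp: dist_norm norm_minus_commute)
  have cu: "norm (conv u \<rho> x - u x) \<le> e" if "norm x \<le> R" for x
  proof (rule conv_dist_le[OF \<rho> u_cont])
    fix y assume "dist x y < s"
    then show "dist (u x) (u y) \<le> e"
      using d2(2) near[OF that] s(4) by (simp add: less_imp_le)
  qed
  have ch: "norm (conv h \<rho> x - h x) \<le> e2" if "norm x \<le> R" for x
  proof (rule conv_dist_le[OF \<rho> h])
    fix y assume "dist x y < s"
    then show "dist (h x) (h y) \<le> e2"
      using d1(2) near[OF that] s(3) by (simp add: less_imp_le)
  qed
  \<comment> \<open>The cut at radius \<open>R + 1\<close> makes the remainder globally
    p-integrable. Since s \<le> 1, mollification at points of the smaller ball never sees the
    cut.\<close>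
  define r where "r x = indicator ?L x *\<^sub>R (G x - h x)" for x
  have [measurable]: "r \<in> borel_measurable borel"
    unfolding r_def[abs_def] by (intro borel_measurable_scaleR borel_measurable_indicator) simp_all
  have r_powr: "norm (r x) powr p = indicator ?L x * norm (G x - h x) powr p" for x
    using p by (simp add: r_def indicator_def)
  have ri: "integrable lborel (\<lambda>x. norm (r x) powr p)" using hi by (simp add: r_powr)
  note rconv = conv_Lp_le[OF \<rho> _ _ ri]
  have split: "conv G \<rho> x = conv r \<rho> x + conv h \<rho> x" if "norm x \<le> R" for x
  proof -
    have "\<rho> (x - y) *\<^sub>R G y = \<rho> (x - y) *\<^sub>R r y + \<rho> (x - y) *\<^sub>R h y" for y
    proof (cases "dist x y < s")
      case True
      then show ?thesis using near(2)[OF that True] by (simp add: r_def algebra_simps)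
    next
      case False
      then show ?thesis using mollifier_support[OF \<rho>, of "x - y"] by (simp add: dist_norm)
    qed
    then show ?thesis unfolding conv_def
      using conv_integrable_Lp(2)[OF \<rho> _ _ ri, of x] conv_integrable[OF h test, of x] p by simp
  qed
  have grad: "grad (conv u \<rho>) x = conv G \<rho> x" for x
    by (rule grad_conv[OF u_cont test weak_gradient])
  let ?f = "\<lambda>x. indicator ?K x * norm (grad (conv u \<rho>) x - G x) powr p"
  let ?g = "\<lambda>x. 3 powr p * (norm (conv r \<rho> x) powr p + indicator ?K x * e2 powr p + norm (r x) powr p)"
  have fin: "integrable lborel (indicator ?K :: 'a \<Rightarrow> real)"
    by (intro integrable_real_indicator) (use emeasure_bounded_finite[of ?K] in auto)
  have gi: "integrable lborel ?g" using fin ri rconv(1) p by auto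
  have le: "?f x \<le> ?g x" for x
  proof (cases "norm x \<le> R")
    case True
    then have "h x - G x = - r x" by (simp add: r_def)
    then have "norm (conv G \<rho> x - G x) = norm (conv r \<rho> x + (conv h \<rho> x - h x) + - r x)"
      unfolding split[OF True] by (simp add: algebra_simps)
    also have "\<dots> \<le> norm (conv r \<rho> x) + norm (conv h \<rho> x - h x) + norm (- r x)"
      using norm_triangle_ineq[of "conv r \<rho> x + (conv h \<rho> x - h x)" "- r x"]
        norm_triangle_ineq[of "conv r \<rho> x" "conv h \<rho> x - h x"] by linarith
    also have "\<dots> \<le> norm (conv r \<rho> x) + e2 + norm (r x)" using ch[OF True] by simp
    finally have "norm (conv G \<rho> x - G x) powr p \<le> (norm (conv r \<rho> x) + e2 + norm (r x)) powr p"
      using p by (intro powr_mono2) auto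
    also have "\<dots> \<le> 3 powr p * (norm (conv r \<rho> x) powr p + e2 powr p + norm (r x) powr p)"
      using p e2 by (intro powr_add3_le) auto
    finally show ?thesis using True by (simp add: grad)
  qed (simp add: add_nonneg_nonneg)
  have [measurable]: "conv G \<rho> \<in> borel_measurable borel" by (rule conv_measurable[OF \<rho>]) simp
  have fi: "integrable lborel ?f"
  proof (rule Bochner_Integration.integrable_bound[OF gi])
    show "?f \<in> borel_measurable lborel" unfolding grad
      by (intro borel_measurable_times borel_measurable_indicator) simp_all
  qed (use le in \<open>auto intro!: AE_I2 order_trans[OF _ abs_ge_self]\<close>)
  have "integral\<^sup>L lborel ?f \<le> integral\<^sup>L lborel ?g" using fi gi le by (intro integral_mono) auto
  also have "\<dots> = 3 powr p * ((\<integral>x. norm (conv r \<rho> x) powr p \<partial>lborel) + V * e2 powr p + (\<integral>x. norm (r x) powr p \<partial>lborel))"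
    using fin ri rconv(1) p by (simp add: V_def)
  also have "\<dots> \<le> 3 powr p * (e1 + e1 + e1)"
  proof (intro mult_left_mono add_mono e2p)
    show "(\<integral>x. norm (r x) powr p \<partial>lborel) \<le> e1" using hle by (simp add: r_powr)
    then show "(\<integral>x. norm (conv r \<rho> x) powr p \<partial>lborel) \<le> e1" using rconv(2) p by simp
  qed auto
  also have "\<dots> = e" by (simp add: e1_def)
  finally have "integral\<^sup>L lborel ?f \<le> e" .
  moreover have "conv u \<rho> x \<ge> 0" for x
    unfolding conv_def
    by (intro Bochner_Integration.integral_nonneg) (simp add: mollifier_nonneg[OF \<rho>] less_imp_le[OF u_pos])
  moreover have "smooth (conv u \<rho>)" by (simp add: C_diff_on_conv[OF u_cont test])
  ultimately show ?thesis using fi cu by (intro exI[of _ "conv u \<rho>"]) simp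
qed

text \<open>This is the weak inequality for the product of u^m and \<eta>. It is tested with w^m
  \<eta> for smooth approximations w of u. The gradient of w is then exchanged for \<open>G\<close>,
  and the error is controlled by Young's inequality.\<close>

lemma test_power_inequality:
  assumes \<eta>: "test_function \<eta>" and \<eta>0: "\<And>x. \<eta> x \<ge> 0" and m: "m \<ge> 1"
  shows "integrable lborel (\<lambda>x. A (G x) \<bullet> ((m * u x ^ (m - 1) * \<eta> x) *\<^sub>R G x + u x ^ m *\<^sub>R grad \<eta> x))"
    and "(\<integral>x. A (G x) \<bullet> ((m * u x ^ (m - 1) * \<eta> x) *\<^sub>R G x + u x ^ m *\<^sub>R grad \<eta> x) \<partial>lborel)
      \<le> - (\<integral>x. u x powr \<alpha> * (u x ^ m * \<eta> x) \<partial>lborel)"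
proof -
  obtain R B where R: "R > 0" and B1: "B \<ge> 1" and B2: "\<forall>x. \<bar>\<eta> x\<bar> \<le> B \<and> norm (grad \<eta> x) \<le> B"
    and out': "\<forall>x. norm x > R \<longrightarrow> \<eta> x = 0 \<and> grad \<eta> x = 0"
    by (rule test_function_bounded[OF \<eta>])
  note B = B1 B2[rule_format, THEN conjunct1] B2[rule_format, THEN conjunct2]
  note out = out'[rule_format, THEN conjunct1] out'[rule_format, THEN conjunct2]
  let ?K = "cball (0::'a) R"
  have [measurable]: "\<eta> \<in> borel_measurable borel" "grad \<eta> \<in> borel_measurable borel"
    by (intro borel_measurable_continuous_onI test_function_continuous[OF \<eta>]
        continuous_on_grad[of 0] spec[OF test_function_smooth[OF \<eta>]])+
  have "bounded (u ` ?K)"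
    by (intro compact_imp_bounded compact_continuous_image continuous_on_subset[OF u_cont]) auto
  then obtain M0 where M0: "\<forall>x\<in>?K. \<bar>u x\<bar> \<le> M0" unfolding bounded_iff by auto
  \<comment> \<open>The slack \<open>M0 + 1\<close> also bounds the approximations, which differ
    from \<open>u\<close> by at most 1 on the ball; M \<ge> 1 makes powers of \<open>M\<close>
    increase with the exponent.\<close>
  define M where "M = max 1 (M0 + 1)"
  have "M0 \<le> M - 1" by (simp add: M_def)
  then have M: "M \<ge> 1" "x \<in> ?K \<Longrightarrow> \<bar>u x\<bar> \<le> M - 1" "x \<in> ?K \<Longrightarrow> \<bar>u x\<bar> \<le> M" for x
    using bspec[OF M0, of x] by (simp add: M_def, linarith, linarith)
  \<comment> \<open>The integrable majorant comes from g^p + g^(p-1) \<le> 1 + 2 g^p, with g the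
    norm of \<open>G x\<close>.\<close>
  define F where "F x = indicator ?K x * (1 + 2 * norm (G x) powr p)" for x
  have fin: "integrable lborel (indicator ?K :: 'a \<Rightarrow> real)"
    by (intro integrable_real_indicator) (use emeasure_bounded_finite[of ?K] in auto)
  have Gi: "integrable lborel (\<lambda>x. indicator ?K x * norm (G x) powr p)" by (rule G_Lp) simp
  have "integrable lborel (\<lambda>x. indicator ?K x + 2 * (indicator ?K x * norm (G x) powr p))"
    using fin Gi by auto
  then have Fi: "integrable lborel F" by (simp add: F_def[abs_def] algebra_simps)
  \<comment> \<open>\<open>w\<close> enters through its values only, with \<open>G\<close> standing
    where the gradient of \<open>w\<close> would be; pointwise convergence of \<open>w\<close> is
    thus enough for the limit of \<open>\<Phi>\<close>.\<close>
  define \<Phi> where "\<Phi> w x = A (G x) \<bullet> ((m * w x ^ (m - 1) * \<eta> x) *\<^sub>R G x + w x ^ m *\<^sub>R grad \<eta> x)"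
    for w :: "'a \<Rightarrow> real" and x
  define D where "D = C * m * M ^ m * B"
  have D: "D \<ge> 0" using C_nonneg M(1) B(1) by (simp add: D_def)
  have pow: "\<bar>t ^ k\<bar> \<le> M ^ m" if "\<bar>t\<bar> \<le> M" "k \<le> m" for t k
  proof -
    have "\<bar>t ^ k\<bar> \<le> M ^ k" using that by (simp add: power_abs power_mono)
    also have "\<dots> \<le> M ^ m" using that M(1) by (intro power_increasing)
    finally show ?thesis .
  qed
  have \<Phi>_le: "\<bar>\<Phi> w x\<bar> \<le> D * F x" if "x \<in> ?K \<Longrightarrow> \<bar>w x\<bar> \<le> M" for w x
  proof (cases "x \<in> ?K")
    case True
    let ?g = "norm (G x)"
    have "\<bar>m * w x ^ (m - 1) * \<eta> x\<bar> \<le> m * M ^ m * B"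
      using pow[OF that[OF True], of "m - 1"] B M(1)
      by (auto simp: abs_mult intro!: mult_mono)
    then have a: "norm ((m * w x ^ (m - 1) * \<eta> x) *\<^sub>R G x) \<le> (m * M ^ m * B) * ?g"
      by (simp add: mult_right_mono)
    have "norm (w x ^ m *\<^sub>R grad \<eta> x) \<le> M ^ m * B"
      using pow[OF that[OF True], of m] B M(1) by (auto intro!: mult_mono)
    also have "\<dots> \<le> m * M ^ m * B" using m M(1) B(1) by simp
    finally have "norm ((m * w x ^ (m - 1) * \<eta> x) *\<^sub>R G x + w x ^ m *\<^sub>R grad \<eta> x) \<le> (m * M ^ m * B) * (?g + 1)"
      using a norm_triangle_ineq[of "(m * w x ^ (m - 1) * \<eta> x) *\<^sub>R G x" "w x ^ m *\<^sub>R grad \<eta> x"]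
      by (simp add: algebra_simps)
    then have "\<bar>\<Phi> w x\<bar> \<le> (C * ?g powr (p - 1)) * ((m * M ^ m * B) * (?g + 1))"
      unfolding \<Phi>_def using C_nonneg
      by (intro order_trans[OF Cauchy_Schwarz_ineq2] mult_mono A_le) auto
    also have "\<dots> = D * (?g powr p + ?g powr (p - 1))"
      using p powr_mult_base[of ?g "p - 1"] by (simp add: D_def algebra_simps)
    also have "\<dots> \<le> D * (1 + 2 * ?g powr p)"
      using powr_Young[of p ?g 1 1] p by (intro mult_left_mono D) auto
    finally show ?thesis using True by (simp add: F_def)
  qed (auto simp: \<Phi>_def out F_def)
  have \<Phi>_int: "integrable lborel (\<Phi> w)"
    if [measurable]: "w \<in> borel_measurable borel" and "\<And>x. x \<in> ?K \<Longrightarrow> \<bar>w x\<bar> \<le> M" for w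
  proof (rule Bochner_Integration.integrable_bound[OF integrable_mult_right[OF Fi, of D]])
    show "\<Phi> w \<in> borel_measurable lborel" unfolding \<Phi>_def[abs_def] by simp
  qed (use \<Phi>_le that in \<open>auto intro!: AE_I2 order_trans[OF _ abs_ge_self]\<close>)
  show "integrable lborel (\<lambda>x. A (G x) \<bullet> ((m * u x ^ (m - 1) * \<eta> x) *\<^sub>R G x + u x ^ m *\<^sub>R grad \<eta> x))"
    using \<Phi>_int[OF u_measurable M(3)] by (simp add: \<Phi>_def[abs_def])
  define \<Psi> where "\<Psi> w x = u x powr \<alpha> * (w x ^ m * \<eta> x)" for w :: "'a \<Rightarrow> real" and x
  define I where "I = (\<integral>x. indicator ?K x * norm (G x) powr p \<partial>lborel)"
  define \<delta> where "\<delta> n = inverse (real (Suc n))" for n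
  have \<delta>: "0 < \<delta> n" "\<delta> n \<le> 1" for n by (auto simp: \<delta>_def field_simps)
  have "\<exists>w. \<forall>n. smooth (w n) \<and> (\<forall>x. w n x \<ge> 0) \<and> (\<forall>x. norm x \<le> R \<longrightarrow> \<bar>w n x - u x\<bar> \<le> \<delta> n) \<and>
      integrable lborel (\<lambda>x. indicator ?K x * norm (grad (w n) x - G x) powr p) \<and>
      (\<integral>x. indicator ?K x * norm (grad (w n) x - G x) powr p \<partial>lborel) \<le> \<delta> n"
    by (rule choice, rule allI) (rule smooth_approximation[OF R \<delta>(1)])
  then obtain w where W: "\<forall>n. smooth (w n) \<and> (\<forall>x. w n x \<ge> 0) \<and> (\<forall>x. norm x \<le> R \<longrightarrow> \<bar>w n x - u x\<bar> \<le> \<delta> n) \<and>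
      integrable lborel (\<lambda>x. indicator ?K x * norm (grad (w n) x - G x) powr p) \<and>
      (\<integral>x. indicator ?K x * norm (grad (w n) x - G x) powr p \<partial>lborel) \<le> \<delta> n" ..
  have w: "smooth (w n)" "w n x \<ge> 0" "norm x \<le> R \<Longrightarrow> \<bar>w n x - u x\<bar> \<le> \<delta> n" for n x
    using spec[OF W, of n] by simp_all
  have wi: "integrable lborel (\<lambda>x. indicator ?K x * norm (grad (w n) x - G x) powr p)"
    and wle: "(\<integral>x. indicator ?K x * norm (grad (w n) x - G x) powr p \<partial>lborel) \<le> \<delta> n" for n
    using spec[OF W, of n] by simp_all
  have wm [measurable]: "w n \<in> borel_measurable borel" "grad (w n) \<in> borel_measurable borel" for n
    by (intro borel_measurable_continuous_onI smooth_continuous[OF w(1)] continuous_on_grad[of 0] spec[OF w(1)])+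
  have wM: "\<bar>w n x\<bar> \<le> M" if "x \<in> ?K" for n x
    using M(2)[OF that] w(3)[of x n] \<delta>(2)[of n] that by auto
  have lim: "(\<lambda>n. w n x) \<longlonglongrightarrow> u x" if "x \<in> ?K" for x
  proof (rule LIM_zero_cancel, rule Lim_null_comparison)
    show "\<forall>\<^sub>F n in sequentially. norm (w n x - u x) \<le> \<delta> n" using w(3) that by (intro always_eventually) auto
    show "\<delta> \<longlonglongrightarrow> 0" unfolding \<delta>_def[abs_def] by (rule LIMSEQ_inverse_real_of_nat)
  qed
  \<comment> \<open>For \<open>u\<close> itself this sum must be shown to be at most 0; for the
    approximations it is bounded by the error of exchanging the gradients.\<close>
  define X where "X n = integral\<^sup>L lborel (\<Phi> (w n)) + integral\<^sup>L lborel (\<Psi> (w n))" for n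
  have nz: "u x \<noteq> 0" for x using u_pos[of x] by simp
  have "bounded ((\<lambda>x. u x powr \<alpha>) ` ?K)"
    by (intro compact_imp_bounded compact_continuous_image continuous_on_powr continuous_on_subset[OF u_cont])
      (simp_all add: nz continuous_on_const)
  then obtain N where "\<forall>y\<in>(\<lambda>x. u x powr \<alpha>) ` ?K. norm y \<le> N" unfolding bounded_iff ..
  then have N: "\<forall>x\<in>?K. u x powr \<alpha> \<le> N" by simp
  have \<Psi>_le: "\<bar>\<Psi> v x\<bar> \<le> (N * (M ^ m * B)) * indicator ?K x" if "x \<in> ?K \<Longrightarrow> \<bar>v x\<bar> \<le> M" for v x
  proof (cases "x \<in> ?K")
    case True
    have "\<bar>\<Psi> v x\<bar> = u x powr \<alpha> * (\<bar>v x ^ m\<bar> * \<bar>\<eta> x\<bar>)" by (simp add: \<Psi>_def abs_mult)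
    also have "\<dots> \<le> N * (M ^ m * B)"
      using N True pow[OF that[OF True], of m] B M(1)
      by (intro mult_mono) (auto intro: order_trans[OF powr_ge_zero])
    finally show ?thesis using True by simp
  qed (auto simp: \<Psi>_def out)
  have \<Psi>_meas: "\<Psi> v \<in> borel_measurable lborel" if [measurable]: "v \<in> borel_measurable borel" for v
    unfolding \<Psi>_def[abs_def] by simp
  have \<Psi>_int: "integrable lborel (\<Psi> (w n))" for n
    by (rule Bochner_Integration.integrable_bound[OF integrable_mult_right[OF fin, of "N * (M ^ m * B)"]])
      (use \<Psi>_le wM \<Psi>_meas wm in \<open>auto intro!: AE_I2 order_trans[OF _ abs_ge_self]\<close>)
  have X_lim: "X \<longlonglongrightarrow> integral\<^sup>L lborel (\<Phi> u) + integral\<^sup>L lborel (\<Psi> u)"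
    unfolding X_def
  proof (rule tendsto_add)
    show "(\<lambda>n. integral\<^sup>L lborel (\<Phi> (w n))) \<longlonglongrightarrow> integral\<^sup>L lborel (\<Phi> u)"
    proof (rule integral_dominated_convergence[where w="\<lambda>x. D * F x"])
      show "AE x in lborel. (\<lambda>n. \<Phi> (w n) x) \<longlonglongrightarrow> \<Phi> u x"
      proof (rule AE_I2)
        fix x
        show "(\<lambda>n. \<Phi> (w n) x) \<longlonglongrightarrow> \<Phi> u x"
        proof (cases "x \<in> ?K")
          case True
          then show ?thesis unfolding \<Phi>_def by (intro tendsto_intros lim)
        qed (simp add: \<Phi>_def out)
      qed
      show "integrable lborel (\<lambda>x. D * F x)" using Fi by simp
    qed (use \<Phi>_le wM \<Phi>_int[OF u_measurable M(3)] \<Phi>_int[OF wm(1) wM] in auto)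
    show "(\<lambda>n. integral\<^sup>L lborel (\<Psi> (w n))) \<longlonglongrightarrow> integral\<^sup>L lborel (\<Psi> u)"
    proof (rule integral_dominated_convergence[where w="\<lambda>x. (N * (M ^ m * B)) * indicator ?K x"])
      show "AE x in lborel. (\<lambda>n. \<Psi> (w n) x) \<longlonglongrightarrow> \<Psi> u x"
      proof (rule AE_I2)
        fix x
        show "(\<lambda>n. \<Psi> (w n) x) \<longlonglongrightarrow> \<Psi> u x"
        proof (cases "x \<in> ?K")
          case True
          then show ?thesis unfolding \<Psi>_def by (intro tendsto_intros lim)
        qed (simp add: \<Psi>_def out)
      qed
      show "integrable lborel (\<lambda>x. (N * (M ^ m * B)) * indicator ?K x)" using fin by simp
    qed (use \<Psi>_le wM \<Psi>_meas[OF u_measurable] \<Psi>_meas[OF wm(1)] in auto)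
  qed
  have bound_lim: "(\<lambda>n. D * (\<delta> n powr (1 / p) * (I + 1))) \<longlonglongrightarrow> D * (0 powr (1 / p) * (I + 1))"
  proof (intro tendsto_intros)
    show "\<delta> \<longlonglongrightarrow> 0" unfolding \<delta>_def[abs_def] by (rule LIMSEQ_inverse_real_of_nat)
  qed (use p less_imp_le[OF \<delta>(1)] in simp_all)
  have "X n \<le> D * (\<delta> n powr (1 / p) * (I + 1))" for n
  proof -
    \<comment> \<open>The Young parameter \<delta>^(1/p) balances the two error terms:
      \<open>?l powr (1 - p) * \<delta> n\<close> equals \<open>?l\<close> again, so both vanish in
      the limit.\<close>
    let ?\<phi> = "\<lambda>x. w n x ^ m * \<eta> x" and ?l = "\<delta> n powr (1 / p)"
    let ?J = "\<lambda>x. (m * w n x ^ (m - 1) * \<eta> x) * (A (G x) \<bullet> (G x - grad (w n) x))"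
    have sm: "smooth (\<lambda>x. w n x ^ m)" using w(1) by (simp add: C_diff_on_power)
    have test: "test_function ?\<phi>" by (rule test_function_mult[OF \<eta> sm])
    have "(?\<phi> has_derivative (\<lambda>v. w n x ^ m * (grad \<eta> x \<bullet> v) + (m * (grad (w n) x \<bullet> v) * w n x ^ (m - 1)) * \<eta> x)) (at x)" for x
    proof -
      have d: "(f has_derivative (\<lambda>v. grad f x \<bullet> v)) (at x)" if "smooth f" for f :: "'a \<Rightarrow> real"
        by (rule has_derivative_grad[OF smooth_differentiable[OF that]])
      show ?thesis
        by (intro has_derivative_mult has_derivative_power d[OF w(1)] d[OF test_function_smooth[OF \<eta>]])
    qed
    then have grad\<phi>: "grad ?\<phi> x = (m * w n x ^ (m - 1) * \<eta> x) *\<^sub>R grad (w n) x + w n x ^ m *\<^sub>R grad \<eta> x" for x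
      by (rule grad_eq) (simp add: inner_add_right inner_commute algebra_simps)
    \<comment> \<open>Subtracting \<open>?J\<close> undoes the exchange of gradients, leaving
      exactly the integrand of the subsolution inequality for \<open>?\<phi>\<close>.\<close>
    have eq: "\<Phi> (w n) x - ?J x = A (G x) \<bullet> grad ?\<phi> x" for x
      unfolding \<Phi>_def grad\<phi> by (simp add: inner_add_right inner_diff_right algebra_simps)
    let ?H = "\<lambda>x. D * (?l * (indicator ?K x * norm (G x) powr p) + ?l powr (1 - p) * (indicator ?K x * norm (grad (w n) x - G x) powr p))"
    have l: "?l > 0" using \<delta>(1)[of n] by simp
    have J_le: "\<bar>?J x\<bar> \<le> ?H x" for x
    proof (cases "x \<in> ?K")
      case True
      have "\<bar>m * w n x ^ (m - 1) * \<eta> x\<bar> \<le> m * M ^ m * B"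
        using pow[OF wM[OF True], of "m - 1"] B M(1)
        by (auto simp: abs_mult intro!: mult_mono)
      moreover have "\<bar>A (G x) \<bullet> (G x - grad (w n) x)\<bar> \<le> (C * norm (G x) powr (p - 1)) * norm (grad (w n) x - G x)"
        using C_nonneg by (intro order_trans[OF Cauchy_Schwarz_ineq2] mult_mono A_le) (auto simp: norm_minus_commute)
      ultimately have "\<bar>?J x\<bar> \<le> (m * M ^ m * B) * ((C * norm (G x) powr (p - 1)) * norm (grad (w n) x - G x))"
        using B M(1) unfolding abs_mult[of "_ * \<eta> x"] by (intro mult_mono) auto
      also have "\<dots> = D * (norm (G x) powr (p - 1) * norm (grad (w n) x - G x))" by (simp add: D_def)
      also have "\<dots> \<le> D * (?l * norm (G x) powr p + ?l powr (1 - p) * norm (grad (w n) x - G x) powr p)"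
        using p l by (intro mult_left_mono D powr_Young) auto
      finally show ?thesis using True by simp
    qed (simp add: out)
    have Hi: "integrable lborel ?H" using Gi wi by auto
    have Ji: "integrable lborel ?J"
      by (rule Bochner_Integration.integrable_bound[OF Hi]) (use J_le in \<open>auto intro!: AE_I2 order_trans[OF _ abs_ge_self]\<close>)
    have "integral\<^sup>L lborel (\<Phi> (w n)) - integral\<^sup>L lborel ?J = (\<integral>x. \<Phi> (w n) x - ?J x \<partial>lborel)"
      using \<Phi>_int[OF wm(1) wM] Ji by simp
    also have "\<dots> \<le> - integral\<^sup>L lborel (\<Psi> (w n))"
      unfolding eq \<Psi>_def using w(2) \<eta>0 by (intro subsolution test) simp
    finally have "X n \<le> integral\<^sup>L lborel ?J" by (simp add: X_def)
    also have "\<dots> \<le> integral\<^sup>L lborel ?H"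
      using J_le by (intro integral_mono Ji Hi) (auto simp: abs_le_iff)
    also have "\<dots> = D * (?l * I + ?l powr (1 - p) * (\<integral>x. indicator ?K x * norm (grad (w n) x - G x) powr p \<partial>lborel))"
      using Gi wi by (simp add: I_def)
    also have "\<dots> \<le> D * (?l * I + ?l powr (1 - p) * \<delta> n)"
      using wle by (intro mult_left_mono add_left_mono D) auto
    also have "?l powr (1 - p) * \<delta> n = ?l"
    proof -
      have "?l powr (1 - p) * \<delta> n = \<delta> n powr ((1 / p) * (1 - p)) * \<delta> n powr 1"
        using \<delta>(1)[of n] by (simp add: powr_powr)
      also have "\<dots> = \<delta> n powr ((1 / p) * (1 - p) + 1)" by (simp only: powr_add)
      also have "(1 / p) * (1 - p) + 1 = 1 / p" using p by (simp add: field_simps)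
      finally show ?thesis .
    qed
    finally show ?thesis by (simp add: algebra_simps)
  qed
  \<comment> \<open>The bound on the right is 0, since \<open>0 powr (1 / p) = 0\<close>.\<close>
  then have "integral\<^sup>L lborel (\<Phi> u) + integral\<^sup>L lborel (\<Psi> u) \<le> D * (0 powr (1 / p) * (I + 1))"
    by (intro LIMSEQ_le[OF X_lim bound_lim] exI allI impI)
  then show "(\<integral>x. A (G x) \<bullet> ((m * u x ^ (m - 1) * \<eta> x) *\<^sub>R G x + u x ^ m *\<^sub>R grad \<eta> x) \<partial>lborel)
      \<le> - (\<integral>x. u x powr \<alpha> * (u x ^ m * \<eta> x) \<partial>lborel)"
    by (simp add: \<Phi>_def[abs_def] \<Psi>_def[abs_def])
qed

end

section \<open>The a priori estimate\<close>

text \<open>Here \<open>s\<close> stands for the norm of the gradient of the solution,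
  \<open>U\<close> for its value and \<open>z\<close> for the logarithmic gradient of the cut-off.
  If E U z \<le> a s, the energy dominates. Otherwise eliminating \<open>s\<close> leaves K z^p
  U^(m+p-1). Either K z^p \<le> U^(\<alpha>-p+1) / 2, and half of the absorption term dominates, or
  \<open>U\<close> is bounded in terms of \<open>z\<close>. The exponent \<gamma> converts that
  bound, as (\<alpha> - p + 1) \<gamma> = m + p - 1.\<close>

lemma absorption_inequality:
  fixes p \<alpha> a E U s z :: real and m :: nat
  assumes p: "p > 1" and \<alpha>: "\<alpha> > p - 1" and a: "a > 0" and E: "E \<ge> 0" and m: "m \<ge> 1"
    and U: "U > 0" and s: "s \<ge> 0" and z: "z \<ge> 0"
  defines "\<gamma> \<equiv> (m + p - 1) / (\<alpha> - p + 1)" and "K \<equiv> E * (E / a) powr (p - 1)"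
  shows "E * s powr (p - 1) * U ^ m * z \<le>
    a * U ^ (m - 1) * s powr p + 1/2 * (U powr \<alpha> * U ^ m) + K * (2 * K) powr \<gamma> * z powr (p + p * \<gamma>)"
proof (cases "E * U * z \<le> a * s")
  case True
  have K: "K \<ge> 0" using E by (simp add: K_def)
  have "U ^ m = U ^ (m - 1) * U" using m by (cases m) auto
  then have "E * s powr (p - 1) * U ^ m * z = (s powr (p - 1) * U ^ (m - 1)) * (E * U * z)" by simp
  also have "\<dots> \<le> (s powr (p - 1) * U ^ (m - 1)) * (a * s)"
    using True U by (intro mult_left_mono) auto
  also have "\<dots> = a * U ^ (m - 1) * s powr p"
    using s powr_mult_base[of s "p - 1"] by (simp add: mult_ac)
  finally have "E * s powr (p - 1) * U ^ m * z \<le> a * U ^ (m - 1) * s powr p" .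
  moreover have "U powr \<alpha> * U ^ m \<ge> 0" and "K * (2 * K) powr \<gamma> * z powr (p + p * \<gamma>) \<ge> 0"
    using U K by simp_all
  ultimately show ?thesis by linarith
next
  case False
  have K: "K \<ge> 0" using E by (simp add: K_def)
  have "s \<le> (E / a) * U * z" using False a by (simp add: field_simps)
  then have "s powr (p - 1) \<le> ((E / a) * U * z) powr (p - 1)" using s p by (intro powr_mono2) auto
  also have "\<dots> = (E / a) powr (p - 1) * U powr (p - 1) * z powr (p - 1)"
    using E a U z by (simp add: powr_mult powr_divide)
  finally have "E * s powr (p - 1) * U ^ m * z \<le>
      E * ((E / a) powr (p - 1) * U powr (p - 1) * z powr (p - 1)) * U ^ m * z"
    using E U z by (intro mult_right_mono mult_left_mono) auto
  also have "\<dots> = K * z powr p * U powr (m + p - 1)"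
  proof -
    have "U powr (m + p - 1) = U powr (p - 1) * U ^ m"
      using U powr_add[of U "p - 1" m] by (simp add: powr_realpow algebra_simps)
    moreover have "z powr p = z powr (p - 1) * z" using z powr_mult_base[of z "p - 1"] by (simp add: mult.commute)
    ultimately show ?thesis by (simp add: K_def)
  qed
  finally have le: "E * s powr (p - 1) * U ^ m * z \<le> K * z powr p * U powr (m + p - 1)" .
  show ?thesis
  proof (cases "K * z powr p \<le> 1/2 * U powr (\<alpha> - p + 1)")
    case True
    have "K * z powr p * U powr (m + p - 1) \<le> (1/2 * U powr (\<alpha> - p + 1)) * U powr (m + p - 1)"
      using True by (intro mult_right_mono) auto
    also have "\<dots> = 1/2 * U powr (\<alpha> + m)" using powr_add[of U "\<alpha> - p + 1" "m + p - 1"] by simp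
    also have "U powr (\<alpha> + m) = U powr \<alpha> * U ^ m" using U by (simp add: powr_add powr_realpow)
    finally have "K * z powr p * U powr (m + p - 1) \<le> 1/2 * (U powr \<alpha> * U ^ m)" by simp
    moreover have "a * U ^ (m - 1) * s powr p \<ge> 0" and "K * (2 * K) powr \<gamma> * z powr (p + p * \<gamma>) \<ge> 0"
      using a U K by simp_all
    ultimately show ?thesis using le by linarith
  next
    case False
    have \<gamma>: "\<gamma> \<ge> 0" using p \<alpha> by (simp add: \<gamma>_def)
    have "U powr (m + p - 1) = (U powr (\<alpha> - p + 1)) powr \<gamma>"
      using \<alpha> by (simp add: powr_powr \<gamma>_def)
    also have "\<dots> \<le> (2 * K * z powr p) powr \<gamma>" using False \<gamma> by (intro powr_mono2) auto
    also have "\<dots> = (2 * K) powr \<gamma> * z powr (p * \<gamma>)" using K by (simp add: powr_mult powr_powr)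
    finally have "K * z powr p * U powr (m + p - 1) \<le> K * z powr p * ((2 * K) powr \<gamma> * z powr (p * \<gamma>))"
      using K by (intro mult_left_mono) auto
    also have "\<dots> = K * (2 * K) powr \<gamma> * z powr (p + p * \<gamma>)" by (simp add: powr_add)
    finally have "K * z powr p * U powr (m + p - 1) \<le> K * (2 * K) powr \<gamma> * z powr (p + p * \<gamma>)" .
    moreover have "a * U ^ (m - 1) * s powr p \<ge> 0" and "U powr \<alpha> * U ^ m \<ge> 0"
      using a U by simp_all
    ultimately show ?thesis using le by linarith
  qed
qed

lemma absorption_inequality_cutoff:
  fixes p \<alpha> a E U s \<theta> \<tau> :: real and m k :: nat
  assumes p: "p > 1" and \<alpha>: "\<alpha> > p - 1" and a: "a > 0" and E: "E \<ge> 0" and m: "m \<ge> 1"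
    and U: "U > 0" and s: "s \<ge> 0" and \<theta>: "0 \<le> \<theta>" "\<theta> \<le> 1" and \<tau>: "\<tau> \<ge> 0"
  defines "\<gamma> \<equiv> (m + p - 1) / (\<alpha> - p + 1)" and "K \<equiv> E * (E / a) powr (p - 1)"
  assumes k: "real k \<ge> p + p * \<gamma>"
  shows "E * s powr (p - 1) * U ^ m * (\<theta> ^ (k - 1) * \<tau>) \<le>
    a * U ^ (m - 1) * s powr p * \<theta> ^ k + 1/2 * (U powr \<alpha> * U ^ m * \<theta> ^ k) + K * (2 * K) powr \<gamma> * \<tau> powr (p + p * \<gamma>)"
proof -
  have K: "K \<ge> 0" using E by (simp add: K_def)
  have "\<gamma> \<ge> 0" using p \<alpha> by (simp add: \<gamma>_def)
  then have "p * \<gamma> \<ge> 0" using p by simp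
  then have k1: "k > 1" using k p by linarith
  show ?thesis
  proof (cases "\<theta> = 0")
    case True
    then show ?thesis using k1 K by (simp add: power_0_left)
  next
    case False
    then have \<theta>0: "\<theta> > 0" using \<theta> by simp
    define z where "z = \<tau> / \<theta>"
    have z: "z \<ge> 0" using \<tau> \<theta> by (simp add: z_def)
    have "\<theta> ^ k = \<theta> * \<theta> ^ (k - 1)" using k1 by (cases k) auto
    then have "\<theta> ^ (k - 1) * \<tau> = z * \<theta> ^ k" using \<theta>0 by (simp add: z_def)
    then have "E * s powr (p - 1) * U ^ m * (\<theta> ^ (k - 1) * \<tau>) = (E * s powr (p - 1) * U ^ m * z) * \<theta> ^ k"
      by simp
    also have "\<dots> \<le> (a * U ^ (m - 1) * s powr p + 1/2 * (U powr \<alpha> * U ^ m) + K * (2 * K) powr \<gamma> * z powr (p + p * \<gamma>)) * \<theta> ^ k"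
      using absorption_inequality[OF p \<alpha> a E m U s z] \<theta>
      by (intro mult_right_mono) (auto simp: K_def \<gamma>_def)
    also have "\<dots> = a * U ^ (m - 1) * s powr p * \<theta> ^ k + 1/2 * (U powr \<alpha> * U ^ m * \<theta> ^ k)
        + K * (2 * K) powr \<gamma> * (z powr (p + p * \<gamma>) * \<theta> ^ k)"
      by (simp add: algebra_simps)
    also have "z powr (p + p * \<gamma>) * \<theta> ^ k = \<tau> powr (p + p * \<gamma>) * \<theta> powr (k - (p + p * \<gamma>))"
      using \<theta>0 \<tau> by (simp add: z_def powr_divide powr_diff powr_realpow)
    also have "\<dots> \<le> \<tau> powr (p + p * \<gamma>) * 1"
      using \<theta> k by (intro mult_left_mono powr_le1) auto
    finally show ?thesis using K by (simp add: mult_left_mono)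
  qed
qed

context coercive_subsolution
begin

text \<open>The energy created by differentiating u^m cancels the energy spent on the mixed term,
  and half of the absorption term survives. The constant precedes the quantifier over
  \<open>R\<close>, so all dependence on the scale is explicit.\<close>

lemma cutoff_estimate:
  fixes m k :: nat
  assumes \<alpha>: "\<alpha> > p - 1" and m: "m \<ge> 1"
  defines "\<gamma> \<equiv> (m + p - 1) / (\<alpha> - p + 1)"
  assumes k: "real k \<ge> p + p * \<gamma>"
  obtains K where "K \<ge> 0" and "\<forall>R>0. integrable lborel (\<lambda>x. u x powr \<alpha> * u x ^ m * bump R x ^ k) \<and>
    (\<integral>x. u x powr \<alpha> * u x ^ m * bump R x ^ k \<partial>lborel) \<le> K * (16 / R) powr (p + p * \<gamma>) * measure lborel (cball (0::'a) R)"
proof -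
  \<comment> \<open>\<open>E\<close> is the factor of the mixed term, with \<open>k\<close> from
    differentiating the k-th power of the cut-off; \<open>a\<close> below is the factor of the
    energy supplied by coercivity, with \<open>m\<close> from differentiating u^m.\<close>
  define E where "E = C * k"
  define a where "a = c * m"
  have a: "a > 0" using c m by (simp add: a_def)
  have E: "E \<ge> 0" using C_nonneg by (simp add: E_def)
  define K0 where "K0 = E * (E / a) powr (p - 1)"
  define K where "K = K0 * (2 * K0) powr \<gamma>"
  have K: "K \<ge> 0" using E by (simp add: K_def K0_def)
  have "\<gamma> \<ge> 0" using p \<alpha> by (simp add: \<gamma>_def)
  then have "p * \<gamma> \<ge> 0" using p by simp
  then have q: "p + p * \<gamma> > 1" using p by linarith
  have "integrable lborel (\<lambda>x. u x powr \<alpha> * u x ^ m * bump R x ^ k) \<and>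
    (\<integral>x. u x powr \<alpha> * u x ^ m * bump R x ^ k \<partial>lborel) \<le> 2 * K * (16 / R) powr (p + p * \<gamma>) * measure lborel (cball (0::'a) R)"
    if R: "R > 0" for R
  proof -
    let ?\<theta> = "bump R :: 'a \<Rightarrow> real" and ?B = "cball (0::'a) R"
    let ?\<eta> = "\<lambda>x. ?\<theta> x ^ k"
    have k1: "k > 1" using q k by linarith
    have test\<theta>: "test_function ?\<theta>" using R by (rule test_function_bump)
    have test: "test_function ?\<eta>"
    proof (rule test_functionI[where r=R])
      show "smooth ?\<eta>" using test_function_smooth[OF test\<theta>] by (simp add: C_diff_on_power)
      show "?\<theta> x ^ k = 0" if "norm x > R" for x using bump_eq_0[OF R, of x] that k1 by (simp add: power_0_left)
    qed
    have grad\<eta>: "grad ?\<eta> x = (k * ?\<theta> x ^ (k - 1)) *\<^sub>R grad ?\<theta> x" for x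
    proof (rule grad_eq)
      have "(?\<theta> has_derivative (\<lambda>v. grad ?\<theta> x \<bullet> v)) (at x)"
        by (rule has_derivative_grad[OF smooth_differentiable[OF test_function_smooth[OF test\<theta>]]])
      then show "(?\<eta> has_derivative (\<lambda>v. k * (grad ?\<theta> x \<bullet> v) * ?\<theta> x ^ (k - 1))) (at x)"
        by (rule has_derivative_power)
    qed (simp add: inner_commute)
    define I where "I x = u x powr \<alpha> * (u x ^ m * ?\<eta> x)" for x
    define P where "P x = A (G x) \<bullet> ((m * u x ^ (m - 1) * ?\<eta> x) *\<^sub>R G x + u x ^ m *\<^sub>R grad ?\<eta> x)" for x
    define T where "T = K * (16 / R) powr (p + p * \<gamma>)"
    have Pint: "integrable lborel P" and Ple: "integral\<^sup>L lborel P \<le> - integral\<^sup>L lborel I"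
      unfolding P_def[abs_def] I_def[abs_def]
      by (intro test_power_inequality[OF test _ m] zero_le_power bump_nonneg)+
    have nz: "u x \<noteq> 0" for x using u_pos[of x] by simp
    have Iint: "integrable lborel I"
    proof (rule integrable_lborel_compact_support)
      show "continuous_on UNIV I" unfolding I_def[abs_def]
        by (intro continuous_intros u_cont test_function_continuous[OF test]) (simp add: nz)
      show "I x = 0" if "x \<notin> ?B" for x
        using bump_eq_0[OF R, of x] that k1 by (simp add: I_def power_0_left)
    qed simp
    have fin: "integrable lborel (indicator ?B :: 'a \<Rightarrow> real)"
      by (intro integrable_real_indicator) (use emeasure_bounded_finite[of ?B] in auto)
    \<comment> \<open>Coercivity compensates the energy term exactly. Integrated and combined with
      \<open>Ple\<close>, this leaves half of the integral of \<open>I\<close> bounded by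
      \<open>T\<close> times the volume of the ball.\<close>
    have low: "- (1/2 * I x) - T * indicator ?B x \<le> P x" for x
    proof -
      let ?s = "norm (G x)" and ?\<tau> = "norm (grad ?\<theta> x)"
      have "\<bar>A (G x) \<bullet> (u x ^ m *\<^sub>R grad ?\<eta> x)\<bar> \<le> (C * ?s powr (p - 1)) * norm (u x ^ m *\<^sub>R grad ?\<eta> x)"
        using C_nonneg by (intro order_trans[OF Cauchy_Schwarz_ineq2] mult_mono A_le) auto
      also have "norm (u x ^ m *\<^sub>R grad ?\<eta> x) = u x ^ m * (k * ?\<theta> x ^ (k - 1) * ?\<tau>)"
        using u_pos[of x] bump_nonneg[of R x] by (simp add: grad\<eta> abs_mult)
      also have "(C * ?s powr (p - 1)) * (u x ^ m * (k * ?\<theta> x ^ (k - 1) * ?\<tau>))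
          = E * ?s powr (p - 1) * u x ^ m * (?\<theta> x ^ (k - 1) * ?\<tau>)" by (simp add: E_def)
      also have "\<dots> \<le> a * u x ^ (m - 1) * ?s powr p * ?\<eta> x + 1/2 * (u x powr \<alpha> * u x ^ m * ?\<eta> x)
          + K0 * (2 * K0) powr \<gamma> * ?\<tau> powr (p + p * \<gamma>)"
        using k unfolding \<gamma>_def K0_def
        by (intro absorption_inequality_cutoff p \<alpha> a E m u_pos bump_nonneg bump_le_1) auto
      also have "K0 * (2 * K0) powr \<gamma> * ?\<tau> powr (p + p * \<gamma>) \<le> T * indicator ?B x"
      proof (cases "x \<in> ?B")
        case True
        have "?\<tau> powr (p + p * \<gamma>) \<le> (16 / R) powr (p + p * \<gamma>)"
          using norm_grad_bump_le[OF R, of x] q by (intro powr_mono2) auto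
        then show ?thesis using True K by (simp add: T_def K_def[symmetric] mult_left_mono)
      next
        case False
        then have "grad ?\<theta> x = 0" using grad_bump_eq_0[OF R, of x] by simp
        then show ?thesis using False by simp
      qed
      finally have 1: "\<bar>A (G x) \<bullet> (u x ^ m *\<^sub>R grad ?\<eta> x)\<bar> \<le> a * u x ^ (m - 1) * ?s powr p * ?\<eta> x + 1/2 * I x + T * indicator ?B x"
        by (simp add: I_def mult.assoc)
      have "(m * u x ^ (m - 1) * ?\<eta> x) * (c * ?s powr p) \<le> (m * u x ^ (m - 1) * ?\<eta> x) * (A (G x) \<bullet> G x)"
        using u_pos[of x] bump_nonneg[of R x] by (intro mult_left_mono A_coercive) auto
      then have 2: "a * u x ^ (m - 1) * ?s powr p * ?\<eta> x \<le> A (G x) \<bullet> ((m * u x ^ (m - 1) * ?\<eta> x) *\<^sub>R G x)"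
        by (simp add: a_def mult_ac)
      show ?thesis using 1 2 unfolding P_def inner_add_right by linarith
    qed
    have "(\<integral>x. - (1/2 * I x) - T * indicator ?B x \<partial>lborel) \<le> integral\<^sup>L lborel P"
      using low by (intro integral_mono Pint) (auto simp: Iint fin)
    moreover have "(\<integral>x. - (1/2 * I x) - T * indicator ?B x \<partial>lborel) = - (1/2 * integral\<^sup>L lborel I) - T * measure lborel ?B"
      using Iint fin by simp
    ultimately have "integral\<^sup>L lborel I \<le> 2 * T * measure lborel ?B" using Ple by simp
    then show ?thesis using Iint by (simp add: I_def[abs_def] T_def mult.assoc)
  qed
  then have "\<forall>R>0. integrable lborel (\<lambda>x. u x powr \<alpha> * u x ^ m * bump R x ^ k) \<and>
    (\<integral>x. u x powr \<alpha> * u x ^ m * bump R x ^ k \<partial>lborel) \<le> 2 * K * (16 / R) powr (p + p * \<gamma>) * measure lborel (cball (0::'a) R)"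
    by (intro allI impI)
  moreover have "2 * K \<ge> 0" using K by simp
  ultimately show ?thesis by (rule that[rotated])
qed

text \<open>On the fixed unit ball the integrand is bounded below by a positive constant independent
  of the scale, whereas the estimate decays like R^(N-q).\<close>

lemma no_coercive_subsolution:
  assumes \<alpha>: "\<alpha> > p - 1"
  shows False
proof -
  let ?N = "DIM('a)"
  \<comment> \<open>This size forces \<gamma> \<ge> N, hence q = p + p \<gamma> > N; the added 1
    guarantees m \<ge> 1.\<close>
  obtain m where m: "real m \<ge> ?N * (\<alpha> - p + 1) + 1" using real_arch_simple by blast
  have "real ?N * (\<alpha> - p + 1) \<ge> 0" using \<alpha> by simp
  with m have "real m \<ge> 1" by linarith
  then have m1: "m \<ge> 1" by simp
  define \<gamma> where "\<gamma> = (m + p - 1) / (\<alpha> - p + 1)"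
  define q where "q = p + p * \<gamma>"
  have "real ?N * (\<alpha> - p + 1) \<le> m + p - 1" using m p by linarith
  then have "\<gamma> \<ge> ?N" using \<alpha> by (simp add: \<gamma>_def pos_le_divide_eq)
  then have "p * \<gamma> \<ge> 1 * real ?N" using p by (intro mult_mono) auto
  then have q: "q > ?N" using p by (simp add: q_def)
  obtain k where k: "real k \<ge> q" using real_arch_simple by blast
  have k': "real k \<ge> p + p * ((m + p - 1) / (\<alpha> - p + 1))" using k by (simp add: q_def \<gamma>_def)
  obtain K where K: "K \<ge> 0" and est: "\<forall>R>0. integrable lborel (\<lambda>x. u x powr \<alpha> * u x ^ m * bump R x ^ k) \<and>
    (\<integral>x. u x powr \<alpha> * u x ^ m * bump R x ^ k \<partial>lborel) \<le> K * (16 / R) powr q * measure lborel (cball (0::'a) R)"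
    unfolding q_def \<gamma>_def by (rule cutoff_estimate[OF \<alpha> m1 k'])
  have nz: "u x \<noteq> 0" for x using u_pos[of x] by simp
  have "continuous_on UNIV (\<lambda>x. u x powr \<alpha> * u x ^ m)"
    by (intro continuous_intros u_cont) (simp add: nz)
  then have "continuous_on (cball 0 1) (\<lambda>x. u x powr \<alpha> * u x ^ m)" by (rule continuous_on_subset) simp
  from continuous_attains_inf[OF compact_cball _ this]
  have "\<exists>x0\<in>cball (0::'a) 1. \<forall>x\<in>cball 0 1. u x0 powr \<alpha> * u x0 ^ m \<le> u x powr \<alpha> * u x ^ m" by simp
  then obtain x0 where x0: "\<forall>x\<in>cball 0 1. u x0 powr \<alpha> * u x0 ^ m \<le> u x powr \<alpha> * u x ^ m" by blast
  define d where "d = u x0 powr \<alpha> * u x0 ^ m * exp (- (1/3)) ^ k"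
  have d: "d > 0" using u_pos[of x0] by (simp add: d_def)
  let ?V = "measure lborel (cball (0::'a) 1)"
  have V: "?V > 0" using content_cball_pos[of 1 "0::'a"] by simp
  have fin: "integrable lborel (indicator (cball (0::'a) 1) :: 'a \<Rightarrow> real)"
    by (intro integrable_real_indicator) (use emeasure_bounded_finite[of "cball (0::'a) 1"] in auto)
  \<comment> \<open>For R \<ge> 2 the unit ball lies in the half ball of radius R / 2, where the
    cut-off is at least exp(-1/3). The volume of the unit ball occurs on both sides and
    cancels.\<close>
  have main: "d \<le> K * 16 powr q * R powr (?N - q)" if R: "R \<ge> 2" for R
  proof -
    have R0: "R > 0" using R by simp
    note est = est[rule_format, OF R0]
    have "d * ?V = (\<integral>x. d * indicator (cball (0::'a) 1) x \<partial>lborel)" by simp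
    also have "\<dots> \<le> (\<integral>x. u x powr \<alpha> * u x ^ m * bump R x ^ k \<partial>lborel)"
    proof (rule integral_mono)
      show "d * indicator (cball 0 1) x \<le> u x powr \<alpha> * u x ^ m * bump R x ^ k" for x
      proof (cases "x \<in> cball 0 1")
        case True
        then have "bump R x \<ge> exp (- (1/3))" using R by (intro bump_ge) auto
        then have "exp (- (1/3)) ^ k \<le> bump R x ^ k" by (intro power_mono) auto
        then have "d \<le> (u x powr \<alpha> * u x ^ m) * bump R x ^ k"
          unfolding d_def using x0 True u_pos[of x] by (intro mult_mono[of "u x0 powr \<alpha> * u x0 ^ m"]) auto
        then show ?thesis using True by simp
      next
        case False
        then show ?thesis using u_pos[of x] bump_nonneg[of R x] by (simp add: less_imp_le)
      qed
    qed (use est fin in auto)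
    also have "\<dots> \<le> K * (16 / R) powr q * measure lborel (cball (0::'a) R)" using est by simp
    also have "measure lborel (cball (0::'a) R) = R ^ ?N * ?V"
      using R0 content_ball_conv_unit_ball[of R "0::'a"] by (simp add: content_cball_conv_ball)
    also have "K * (16 / R) powr q * (R ^ ?N * ?V) = K * 16 powr q * R powr (?N - q) * ?V"
      using R0 by (simp add: powr_divide powr_diff powr_realpow)
    finally show ?thesis using V by simp
  qed
  have "((\<lambda>R. K * 16 powr q * R powr (?N - q)) \<longlongrightarrow> K * 16 powr q * 0) at_top"
    using q by (intro tendsto_mult_left tendsto_neg_powr filterlim_ident) auto
  moreover have "\<forall>\<^sub>F R in at_top. d \<le> K * 16 powr q * R powr (?N - q)"
    using eventually_ge_at_top[of 2] by eventually_elim (rule main)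
  ultimately have "d \<le> K * 16 powr q * 0" by (intro tendsto_lowerbound) auto
  with d show False by simp
qed

end

section \<open>Anisotropic fluxes\<close>

context
  fixes H :: "'a::euclidean_space \<Rightarrow> real" and p :: real
  assumes H_C2: "C_diff_on 2 H (UNIV - {0})"
    and H_hom: "\<And>t \<xi>. t > 0 \<Longrightarrow> H (t *\<^sub>R \<xi>) = t * H \<xi>"
    and H_pos_sphere: "\<And>\<xi>. \<xi> \<in> sphere 0 1 \<Longrightarrow> H \<xi> > 0"
    and p1: "p > 1"
begin

lemma H_scale: "H \<xi> = norm \<xi> * H (sgn \<xi>)" if "\<xi> \<noteq> 0"
  using H_hom[of "norm \<xi>" "sgn \<xi>"] that by (simp add: sgn_div_norm)

lemma H_pos: "\<xi> \<noteq> 0 \<Longrightarrow> H \<xi> > 0"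
  using H_scale[of \<xi>] H_pos_sphere[of "sgn \<xi>"] by (simp add: norm_sgn)

lemma H_has_derivative: "\<xi> \<noteq> 0 \<Longrightarrow> (H has_derivative (\<lambda>v. grad H \<xi> \<bullet> v)) (at \<xi>)"
  using H_C2 by (intro has_derivative_grad) (simp add: numeral_2_eq_2)

lemma continuous_grad_H: "continuous_on (UNIV - {0}) (grad H)"
  using H_C2 by (intro continuous_on_grad[of 1]) (simp add: numeral_2_eq_2)

lemma continuous_H: "continuous_on (UNIV - {0}) H"
  using H_C2 by (rule C_diff_on_continuous)

text \<open>Differentiating \<eta> \<mapsto> H (t \<eta>) by the chain rule and by homogeneity gives
  two expressions, and the factor t cancels.\<close>

lemma grad_H_scale:
  assumes "\<xi> \<noteq> 0" "t > 0" shows "grad H (t *\<^sub>R \<xi>) = grad H \<xi>"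
proof -
  have "((\<lambda>\<eta>. H (t *\<^sub>R \<eta>)) has_derivative (\<lambda>v. grad H (t *\<^sub>R \<xi>) \<bullet> (t *\<^sub>R v))) (at \<xi>)"
    by (rule has_derivative_compose[OF _ H_has_derivative])
      (use assms in \<open>auto intro!: derivative_eq_intros\<close>)
  then have 1: "grad (\<lambda>\<eta>. H (t *\<^sub>R \<eta>)) \<xi> = t *\<^sub>R grad H (t *\<^sub>R \<xi>)"
    by (rule grad_eq) (simp add: inner_commute)
  have "((\<lambda>\<eta>. H (t *\<^sub>R \<eta>)) has_derivative (\<lambda>v. t * (grad H \<xi> \<bullet> v))) (at \<xi>)"
    unfolding H_hom[OF assms(2)] by (rule has_derivative_mult_right[OF H_has_derivative[OF assms(1)]])
  then have "grad (\<lambda>\<eta>. H (t *\<^sub>R \<eta>)) \<xi> = t *\<^sub>R grad H \<xi>"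
    by (rule grad_eq) (simp add: inner_commute)
  with 1 assms show ?thesis by simp
qed

text \<open>The derivative of t \<mapsto> H (t \<xi>) at t = 1 is computed by the chain rule and
  from its linear form t H \<xi>.\<close>

lemma Euler_identity:
  assumes "\<xi> \<noteq> 0" shows "grad H \<xi> \<bullet> \<xi> = H \<xi>"
proof -
  have d: "((\<lambda>t::real. H (t *\<^sub>R \<xi>)) has_derivative (\<lambda>h. grad H (1 *\<^sub>R \<xi>) \<bullet> (h *\<^sub>R \<xi>))) (at 1)"
    by (rule has_derivative_compose[OF _ H_has_derivative])
      (use assms in \<open>auto intro!: derivative_eq_intros\<close>)
  have "((\<lambda>t::real. t * H \<xi>) has_derivative (\<lambda>h. grad H (1 *\<^sub>R \<xi>) \<bullet> (h *\<^sub>R \<xi>))) (at 1)"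
    by (rule has_derivative_transform_within_open[OF d, where s="{0<..}"]) (auto simp: H_hom)
  moreover have "((\<lambda>t::real. t * H \<xi>) has_derivative (\<lambda>h. h * H \<xi>)) (at 1)"
    by (auto intro!: derivative_eq_intros)
  ultimately have "(\<lambda>h. grad H (1 *\<^sub>R \<xi>) \<bullet> (h *\<^sub>R \<xi>)) = (\<lambda>h. h * H \<xi>)"
    by (rule has_derivative_unique)
  from fun_cong[OF this, of 1] show ?thesis by simp
qed

lemma aniso_flux_eq:
  assumes "\<xi> \<noteq> 0" shows "aniso_flux H p \<xi> = H \<xi> powr (p - 1) *\<^sub>R grad H \<xi>"
proof -
  have "((\<lambda>x. x powr p) has_derivative (*) (p * H \<xi> powr (p - 1))) (at (H \<xi>))"
    using H_pos[OF assms] p1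
    by (intro has_field_derivative_imp_has_derivative) (auto intro!: derivative_eq_intros)
  from has_derivative_compose[OF H_has_derivative[OF assms] this]
  have "grad (\<lambda>\<eta>. H \<eta> powr p) \<xi> = (p * H \<xi> powr (p - 1)) *\<^sub>R grad H \<xi>"
    by (rule grad_eq) (simp add: inner_commute)
  then show ?thesis using assms p1 by (simp add: aniso_flux_def)
qed

text \<open>Off the origin the flux is a continuous expression, and its prescribed value 0 at the
  origin agrees with extension by an indicator.\<close>

lemma aniso_flux_measurable: "aniso_flux H p \<in> borel_measurable borel"
proof -
  have "continuous_on (UNIV - {0}) (\<lambda>\<xi>. H \<xi> powr (p - 1) *\<^sub>R grad H \<xi>)"
    by (intro continuous_intros continuous_H continuous_grad_H) (metis Diff_iff H_pos less_irrefl singletonI)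
  then have "(\<lambda>\<xi>. indicator (UNIV - {0}) \<xi> *\<^sub>R (H \<xi> powr (p - 1) *\<^sub>R grad H \<xi>)) \<in> borel_measurable borel"
    by (intro borel_measurable_continuous_on_indicator) auto
  moreover have "(\<lambda>\<xi>. indicator (UNIV - {0}) \<xi> *\<^sub>R (H \<xi> powr (p - 1) *\<^sub>R grad H \<xi>)) = aniso_flux H p"
    by (rule ext) (simp add: indicator_def aniso_flux_eq aniso_flux_def[of _ _ 0])
  ultimately show ?thesis by simp
qed

lemma aniso_flux_scale:
  assumes "\<xi> \<noteq> 0"
  shows "aniso_flux H p \<xi> = norm \<xi> powr (p - 1) *\<^sub>R aniso_flux H p (sgn \<xi>)"
proof -
  have s: "sgn \<xi> \<noteq> 0" using assms by (simp add: sgn_zero_iff)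
  have "grad H \<xi> = grad H (sgn \<xi>)"
    using grad_H_scale[of "sgn \<xi>" "norm \<xi>"] assms s by (simp add: sgn_div_norm)
  moreover have "H \<xi> powr (p - 1) = norm \<xi> powr (p - 1) * H (sgn \<xi>) powr (p - 1)"
    using H_scale[OF assms] H_pos[OF s] by (simp add: powr_mult)
  ultimately show ?thesis using assms s by (simp add: aniso_flux_eq)
qed

text \<open>Both bounds are compactness on the unit sphere propagated by homogeneity:
  \<open>C\<close> bounds the flux there, and \<open>c\<close> is the p-th power of the minimum of
  \<open>H\<close>. Euler's identity makes the flux paired with \<xi> equal to
  \<open>H \<xi> powr p\<close>.\<close>

lemma aniso_flux_bounds:
  obtains C c where "c > 0" and "\<forall>\<xi>. norm (aniso_flux H p \<xi>) \<le> C * norm \<xi> powr (p - 1)"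
    and "\<forall>\<xi>. c * norm \<xi> powr p \<le> aniso_flux H p \<xi> \<bullet> \<xi>"
proof -
  let ?S = "sphere (0::'a) 1"
  have S: "?S \<subseteq> UNIV - {0}" by auto
  have cont: "continuous_on ?S H" "continuous_on ?S (grad H)"
    using continuous_on_subset[OF continuous_H S] continuous_on_subset[OF continuous_grad_H S] by auto
  have "continuous_on ?S (\<lambda>\<xi>. H \<xi> powr (p - 1) *\<^sub>R grad H \<xi>)"
    by (intro continuous_intros cont) (metis H_pos_sphere less_irrefl)
  then have "bounded ((\<lambda>\<xi>. H \<xi> powr (p - 1) *\<^sub>R grad H \<xi>) ` ?S)"
    by (intro compact_imp_bounded compact_continuous_image) auto
  then obtain C where "\<forall>y\<in>(\<lambda>\<xi>. H \<xi> powr (p - 1) *\<^sub>R grad H \<xi>) ` ?S. norm y \<le> C" unfolding bounded_iff ..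
  then have C: "norm (H \<xi> powr (p - 1) *\<^sub>R grad H \<xi>) \<le> C" if "\<xi> \<in> ?S" for \<xi> using that by blast
  obtain b :: 'a where "b \<in> Basis" using nonempty_Basis by blast
  then have "?S \<noteq> {}" by auto
  from continuous_attains_inf[OF compact_sphere this cont(1)]
  obtain \<xi>0 where \<xi>0: "\<xi>0 \<in> ?S" "\<forall>\<xi>\<in>?S. H \<xi>0 \<le> H \<xi>" by blast
  define c where "c = H \<xi>0 powr p"
  have H0: "H \<xi>0 > 0" using H_pos_sphere[OF \<xi>0(1)] .
  have sg: "sgn \<xi> \<in> ?S" "sgn \<xi> \<noteq> 0" if "\<xi> \<noteq> 0" for \<xi> :: 'a
    using that by (auto simp: norm_sgn sgn_zero_iff)
  have "norm (aniso_flux H p \<xi>) \<le> C * norm \<xi> powr (p - 1)" for \<xi>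
  proof (cases "\<xi> = 0")
    case False
    have "norm (aniso_flux H p \<xi>) = norm \<xi> powr (p - 1) * norm (aniso_flux H p (sgn \<xi>))"
      unfolding aniso_flux_scale[OF False] by simp
    also have "\<dots> \<le> norm \<xi> powr (p - 1) * C"
      using C[OF sg(1)[OF False]] by (intro mult_left_mono) (auto simp: aniso_flux_eq[OF sg(2)[OF False]])
    finally show ?thesis by (simp add: mult.commute)
  qed (simp add: aniso_flux_def)
  moreover have "c * norm \<xi> powr p \<le> aniso_flux H p \<xi> \<bullet> \<xi>" for \<xi>
  proof (cases "\<xi> = 0")
    case False
    have "c * norm \<xi> powr p \<le> H (sgn \<xi>) powr p * norm \<xi> powr p"
      unfolding c_def using \<xi>0(2) sg(1)[OF False] H0 p1 by (intro mult_right_mono powr_mono2) auto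
    also have "\<dots> = H \<xi> powr p"
      using H_scale[OF False] H_pos[OF sg(2)[OF False]] by (simp add: powr_mult mult.commute)
    also have "\<dots> = aniso_flux H p \<xi> \<bullet> \<xi>"
      using powr_mult_base[of "H \<xi>" "p - 1"] H_pos[OF False]
      by (simp add: aniso_flux_eq[OF False] Euler_identity[OF False] mult.commute)
    finally show ?thesis .
  qed (simp add: aniso_flux_def)
  moreover have "c > 0" using H0 by (simp add: c_def)
  ultimately show ?thesis by (intro that[of c C] allI)
qed

end

text \<open>Each coordinate agrees almost everywhere with a Borel function, and finitely many
  exceptional null sets can be united.\<close>

lemma lebesgue_borel_representative:
  fixes g :: "'a::euclidean_space \<Rightarrow> 'b::euclidean_space"
  assumes "g \<in> borel_measurable lebesgue"
  obtains G where "G \<in> borel_measurable borel" and "AE x in lborel. g x = G x"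
proof -
  have "\<forall>b\<in>Basis. \<exists>h. h \<in> borel_measurable lborel \<and> (AE x in lborel. g x \<bullet> b = h x)"
  proof
    fix b :: 'b
    have "(\<lambda>x. g x \<bullet> b) \<in> borel_measurable lebesgue" using assms by simp
    then show "\<exists>h. h \<in> borel_measurable lborel \<and> (AE x in lborel. g x \<bullet> b = h x)"
      using completion_ex_borel_measurable_real by blast
  qed
  from bchoice[OF this] obtain h where
    h: "\<forall>b\<in>Basis. h b \<in> borel_measurable lborel \<and> (AE x in lborel. g x \<bullet> b = h b x)" ..
  have "AE x in lborel. \<forall>b\<in>Basis. g x \<bullet> b = h b x"
    using h by (intro AE_finite_allI) auto
  then have "AE x in lborel. g x = (\<Sum>b\<in>Basis. h b x *\<^sub>R b)"
  proof eventually_elim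
    fix x assume "\<forall>b\<in>Basis. g x \<bullet> b = h b x"
    then have "(\<Sum>b\<in>Basis. h b x *\<^sub>R b) = (\<Sum>b\<in>Basis. (g x \<bullet> b) *\<^sub>R b)" by (intro sum.cong) auto
    then show "g x = (\<Sum>b\<in>Basis. h b x *\<^sub>R b)" by (simp add: euclidean_representation)
  qed
  moreover have "(\<lambda>x. \<Sum>b\<in>Basis. h b x *\<^sub>R b) \<in> borel_measurable borel"
    using h by (intro borel_measurable_sum borel_measurable_scaleR) auto
  ultimately show ?thesis by (intro that)
qed

lemma integral_lebesgue_representative:
  fixes f h :: "'a::euclidean_space \<Rightarrow> 'b::euclidean_space"
  assumes f: "f \<in> borel_measurable lebesgue" and h: "h \<in> borel_measurable borel" and ae: "AE x in lborel. f x = h x"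
  shows "integral\<^sup>L lebesgue f = integral\<^sup>L lborel h" and "integrable lebesgue f \<longleftrightarrow> integrable lborel h"
proof -
  have h': "h \<in> borel_measurable lborel" using h by simp
  have ae': "AE x in lebesgue. f x = h x" using ae by (rule AE_completion)
  have h'': "h \<in> borel_measurable lebesgue" using h' by (rule measurable_completion)
  show "integral\<^sup>L lebesgue f = integral\<^sup>L lborel h"
    using integral_cong_AE[OF f h'' ae'] integral_completion[OF h'] by simp
  show "integrable lebesgue f \<longleftrightarrow> integrable lborel h"
    using integrable_cong_AE[OF f h'' ae'] integrable_completion[OF h'] by simp
qed

theorem corollary1p3:
  fixes H :: "real ^ 'n \<Rightarrow> real" and p \<alpha> :: real
  assumes "CARD('n) \<ge> 2"
    and "C_diff_on 2 H (UNIV - {0})"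
    and "continuous_on UNIV H"
    and "\<And>t \<xi>. t > 0 \<Longrightarrow> H (t *\<^sub>R \<xi>) = t * H \<xi>"
    and "H 0 = 0"
    and "\<And>\<xi>. \<xi> \<in> sphere 0 1 \<Longrightarrow> H \<xi> > 0"
    and "uniformly_convex H"
    and "p - 1 > 0" and "\<alpha> > p - 1"
  shows "\<not> (\<exists>u. positive_subsolution H p \<alpha> u)"
proof
  assume "\<exists>u. positive_subsolution H p \<alpha> u"
  then obtain u where sub: "positive_subsolution H p \<alpha> u" ..
  have p: "p > 1" using assms(8) by simp
  note flux = assms(2,4,6) p
  define g where "g = weak_grad u"
  have u_cont: "continuous_on UNIV u" and u_pos: "u x > 0" for x
    using sub by (auto simp: positive_subsolution_def)
  have W: "u \<in> W1p_loc p" using sub by (simp add: positive_subsolution_def)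
  then have "\<exists>g. has_weak_gradient u g" by (simp add: W1p_loc_def)
  \<comment> \<open>\<open>weak_grad\<close> is an arbitrary choice; membership in
    \<open>W1p_loc\<close> supplies the existence that gives the choice its defining
    property.\<close>
  then have wg: "has_weak_gradient u g" unfolding g_def weak_grad_def by (rule someI_ex)
  have gLp: "g \<in> Lp_loc p" using W by (simp add: W1p_loc_def g_def)
  then have g_meas: "g \<in> borel_measurable lebesgue" by (simp add: Lp_loc_def)
  obtain G where G [measurable]: "G \<in> borel_measurable borel" and ae: "AE x in lborel. g x = G x"
    by (rule lebesgue_borel_representative[OF g_meas])
  obtain C c where c: "c > 0" and C: "\<forall>\<xi>. norm (aniso_flux H p \<xi>) \<le> C * norm \<xi> powr (p - 1)"
    and co: "\<forall>\<xi>. c * norm \<xi> powr p \<le> aniso_flux H p \<xi> \<bullet> \<xi>"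
    by (rule aniso_flux_bounds[OF flux])
  have A [measurable]: "aniso_flux H p \<in> borel_measurable borel" by (rule aniso_flux_measurable[OF flux])
  have g_leb [measurable]: "g \<in> borel_measurable lebesgue" by (rule g_meas)
  have borel_leb: "f \<in> borel_measurable lebesgue" if "f \<in> borel_measurable borel"
    for f :: "real ^ 'n \<Rightarrow> 'b::euclidean_space"
    using that by (simp add: measurable_completion)
  have u_meas: "u \<in> borel_measurable borel" using u_cont by (rule borel_measurable_continuous_onI)
  have \<phi>_meas: "\<phi> \<in> borel_measurable borel" "grad \<phi> \<in> borel_measurable borel" if "test_function \<phi>" for \<phi> :: "real ^ 'n \<Rightarrow> real"
    by (intro borel_measurable_continuous_onI test_function_continuous[OF that]
        continuous_on_grad[of 0] spec[OF test_function_smooth[OF that]])+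
  \<comment> \<open>Each integral in the definitions is taken over \<open>lebesgue\<close> with
    \<open>g\<close>; it is moved to \<open>lborel\<close> with \<open>G\<close>, the two gradients
    being equal almost everywhere.\<close>
  have "coercive_subsolution u G (aniso_flux H p) p \<alpha> C c"
  proof
    fix K :: "(real ^ 'n) set" assume K: "compact K"
    have "K \<in> sets borel" using K by (simp add: borel_compact)
    then have Km [measurable]: "indicator K \<in> borel_measurable borel" by (rule borel_measurable_indicator)
    note [measurable] = borel_leb[OF Km]
    have "integrable lebesgue (\<lambda>x. indicator K x * norm (g x) powr p)"
      using gLp K by (simp add: Lp_loc_def set_integrable_def)
    moreover have "AE x in lborel. indicator K x * norm (g x) powr p = indicator K x * norm (G x) powr p"
      using ae by eventually_elim simp
    ultimately show "integrable lborel (\<lambda>x. indicator K x * norm (G x) powr p)"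
      by (subst integral_lebesgue_representative(2)[symmetric]) auto
  next
    fix \<phi> :: "real ^ 'n \<Rightarrow> real" assume \<phi>: "test_function \<phi>"
    note [measurable] = \<phi>_meas[OF \<phi>] u_meas borel_leb[OF \<phi>_meas(1)[OF \<phi>]]
    have "(\<integral>x. u x *\<^sub>R grad \<phi> x \<partial>lborel) = (\<integral>x. u x *\<^sub>R grad \<phi> x \<partial>lebesgue)"
      by (rule integral_completion[symmetric]) simp
    also have "\<dots> = - (\<integral>x. \<phi> x *\<^sub>R g x \<partial>lebesgue)" using wg \<phi> by (simp add: has_weak_gradient_def)
    also have "(\<integral>x. \<phi> x *\<^sub>R g x \<partial>lebesgue) = (\<integral>x. \<phi> x *\<^sub>R G x \<partial>lborel)"
    proof (rule integral_lebesgue_representative(1))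
      show "AE x in lborel. \<phi> x *\<^sub>R g x = \<phi> x *\<^sub>R G x" using ae by eventually_elim simp
    qed simp_all
    finally show "(\<integral>x. u x *\<^sub>R grad \<phi> x \<partial>lborel) = - (\<integral>x. \<phi> x *\<^sub>R G x \<partial>lborel)" .
  next
    fix \<phi> :: "real ^ 'n \<Rightarrow> real" assume \<phi>: "test_function \<phi>" and \<phi>0: "\<And>x. \<phi> x \<ge> 0"
    note [measurable] = \<phi>_meas[OF \<phi>] u_meas borel_leb[OF \<phi>_meas(2)[OF \<phi>]]
    have "(\<integral>x. aniso_flux H p (G x) \<bullet> grad \<phi> x \<partial>lborel) = (\<integral>x. aniso_flux H p (g x) \<bullet> grad \<phi> x \<partial>lebesgue)"
    proof (rule integral_lebesgue_representative(1)[symmetric])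
      show "AE x in lborel. aniso_flux H p (g x) \<bullet> grad \<phi> x = aniso_flux H p (G x) \<bullet> grad \<phi> x"
        using ae by eventually_elim simp
      show "(\<lambda>x. aniso_flux H p (g x) \<bullet> grad \<phi> x) \<in> borel_measurable lebesgue"
        by (intro borel_measurable_inner measurable_compose[OF g_meas A] borel_leb \<phi>_meas(2)[OF \<phi>])
    qed simp
    also have "\<dots> \<le> - (\<integral>x. u x powr \<alpha> * \<phi> x \<partial>lebesgue)"
      using sub \<phi> \<phi>0 by (simp add: positive_subsolution_def g_def)
    also have "(\<integral>x. u x powr \<alpha> * \<phi> x \<partial>lebesgue) = (\<integral>x. u x powr \<alpha> * \<phi> x \<partial>lborel)"
      by (rule integral_completion) simp
    finally show "(\<integral>x. aniso_flux H p (G x) \<bullet> grad \<phi> x \<partial>lborel) \<le> - (\<integral>x. u x powr \<alpha> * \<phi> x \<partial>lborel)" .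
  qed (use p c u_cont u_pos G A C co in auto)
  then show False using assms(9) by (rule coercive_subsolution.no_coercive_subsolution)
qed

end
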